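(* For every integer $k\geq 1$, the $k$-abelian complexity function $(\mathcal{P}^{(k)}_{\mathbf{c}}(n))_{n\geq1}$ of the Cantor sequence $\mathbf c$ is a $3$-regular sequence.
   Context: The Cantor sequence $\mathbf{c}=c_0c_1c_2\cdots\in\{0,1\}^{\mathbb N}$ is defined by $c_0=1$ and $c_{3n}=c_{3n+2}=c_n$, $c_{3n+1}=0$ for all $n\geq 0$. A factor of $\mathbf c$ is a finite word $c_ic_{i+1}\cdots c_{i+m-1}$; $\mathcal F_{\mathbf c}(n)$ is the set of factors of length $n$. For a word $u=u_0\cdots u_{n-1}$ and $\ell\geq1$, $\mathrm{pref}_\ell(u)=u_0\cdots u_{\ell-1}$, $\mathrm{suff}_\ell(u)=u_{n-\ell}\cdots u_{n-1}$; for $\ell\le0$ both are the empty word. $|u|_w$ is the number of occurrences of $w$ in $u$. Two words $u,v$ are $k$-abelian equivalent ($u\sim_k v$) if $\mathrm{pref}_{k-1}(u)=\mathrm{pref}_{k-1}(v)$, $\mathrm{suff}_{k-1}(u)=\mathrm{suff}_{k-1}(v)$ and $|u|_w=|v|_w$ for every word $w$ of length $k$. The $k$-abelian complexity is $\mathcal P^{(k)}_{\mathbf c}(n)=\mathrm{Card}(\mathcal F_{\mathbf c}(n)/\sim_k)$ for $n\ge1$. For an integer $b\geq2$, an integer sequence $\mathbf w=(w_n)$ is $b$-regular if the $\mathbb Z$-module generated by its $b$-kernel $\{(w_{b^en+r})_{n}\mid e\geq0,\ 0\le r<b^e\}$ is finitely generated. *)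

theory Defs
  imports Complex_Main "HOL-Library.Function_Algebras"
begin

function cantor :: "nat \<Rightarrow> nat" where
  "cantor n = (if n = 0 then 1 else if n mod 3 = 1 then 0 else cantor (n div 3))"
  by auto
termination by (relation "measure id") auto

declare cantor.simps [simp del]

lemma cantor_rec:
  "cantor 0 = 1"
  "cantor (3 * n) = cantor n"
  "cantor (3 * n + 1) = 0"
  "cantor (3 * n + 2) = cantor n"
proof -
  show zero: "cantor 0 = 1"
    by (simp add: cantor.simps)
  show "cantor (3 * n) = cantor n"
    by (cases "n = 0") (simp_all add: cantor.simps [of "3 * n"] zero)
  have "(3 * n + 1) mod 3 = 1" by presburger
  then show "cantor (3 * n + 1) = 0"
    by (subst cantor.simps) simp
  have "(3 * n + 2) mod 3 = 2" "(3 * n + 2) div 3 = n" by presburger+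
  then show "cantor (3 * n + 2) = cantor n"
    by (subst cantor.simps) simp
qed

definition factors :: "(nat \<Rightarrow> 'a) \<Rightarrow> nat \<Rightarrow> 'a list set" where
  "factors s n = {map s [i..<i + n] | i. True}"

text \<open>If a word is shorter than the requested length, its prefix and its suffix
  are the whole word.\<close>

definition pref :: "nat \<Rightarrow> 'a list \<Rightarrow> 'a list" where
  "pref l u = take l u"

definition suff :: "nat \<Rightarrow> 'a list \<Rightarrow> 'a list" where
  "suff l u = drop (length u - l) u"

definition occ :: "'a list \<Rightarrow> 'a list \<Rightarrow> nat" where
  "occ u w = card {i. i + length w \<le> length u \<and> take (length w) (drop i u) = w}"

text \<open>Truncated subtraction is harmless, as only \<open>k \<ge> 1\<close> is of interest.  The words \<open>w\<close>
  range over the whole letter type; a word containing a letter that occurs in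
  neither \<open>u\<close> nor \<open>v\<close> has no occurrence in either of them.\<close>

definition kab_equiv :: "nat \<Rightarrow> 'a list \<Rightarrow> 'a list \<Rightarrow> bool" where
  "kab_equiv k u v \<longleftrightarrow>
     pref (k - 1) u = pref (k - 1) v \<and> suff (k - 1) u = suff (k - 1) v \<and>
     (\<forall>w. length w = k \<longrightarrow> occ u w = occ v w)"

text \<open>At \<open>n = 0\<close> the only factor is the empty word, so the value is \<open>1\<close>.  Regularity is
  insensitive to changing finitely many terms, so including this term in the sequence
  \<open>n \<ge> 1\<close> (the kernel is indexed from \<open>0\<close>) makes no difference.\<close>

definition kab_complexity :: "nat \<Rightarrow> (nat \<Rightarrow> 'a) \<Rightarrow> nat \<Rightarrow> nat" where
  "kab_complexity k s n =
     card (factors s n //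
       {(u, v). u \<in> factors s n \<and> v \<in> factors s n \<and> kab_equiv k u v})"

lemma equiv_kab_equiv:
  "equiv (factors s n) {(u, v). u \<in> factors s n \<and> v \<in> factors s n \<and> kab_equiv k u v}"
  by (rule equivI) (auto simp: refl_on_def sym_def trans_def kab_equiv_def)

text \<open>Integer sequences form a \<open>\<int>\<close>-module under pointwise operations.\<close>

global_interpretation int_seq: module "\<lambda>(a :: int) (f :: nat \<Rightarrow> int) n. a * f n"
  by unfold_locales (auto simp: fun_eq_iff algebra_simps)

definition kernel_seqs :: "nat \<Rightarrow> (nat \<Rightarrow> int) \<Rightarrow> (nat \<Rightarrow> int) set" where
  "kernel_seqs b w = {\<lambda>n. w (b ^ e * n + r) | e r. r < b ^ e}"

definition regular_seq :: "nat \<Rightarrow> (nat \<Rightarrow> int) \<Rightarrow> bool" where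
  "regular_seq b w \<longleftrightarrow>
     (\<exists>G. finite G \<and> int_seq.span G = int_seq.span (kernel_seqs b w))"

end

theory Submission
  imports Defs
begin

text \<open>
  Let \<open>l = k - 1 > 0\<close> and let \<open>B = 3 ^ m\<close> be the least power of \<open>3\<close> with \<open>l \<le> B\<close>.  The sequence is
  made of copies of \<open>W = c[0..B)\<close> and of zero blocks of length \<open>B\<close>, and no two copies of \<open>W\<close> are
  adjacent.  By the choice of \<open>m\<close>, no \<open>l\<close> consecutive letters of \<open>W\<close> vanish, so a word of length
  \<open>l\<close> is zero precisely if it meets no copy of \<open>W\<close>; otherwise it meets exactly one, and its state
  is its position relative to this copy, while zero words have state \<open>0\<close>.  The numbers of
  occurrences of words of length \<open>k\<close> in a factor depend only on the state of its prefix, the state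
  of its suffix, and the number of blocks between the two.

  If prefix or suffix is zero, these three data can be recovered from the class of the factor:
  the number of ones in the factor gives the number of blocks, as well as the number of ones of
  the cut block.  For fixed states the numbers of blocks that occur form an interval, whose length
  is essentially \<open>A((n + c) div B)\<close>, where \<open>A(n)\<close> is the number of ones in \<open>c[0..n)\<close>.  If both prefix
  and suffix are nonzero, then the distance between two ones determines the number of ones between
  them, because it has a unique expansion in base \<open>3\<close> with digits \<open>-2, 0, 2\<close>; moreover a distance is
  realised if and only if it is even.  Hence these classes contribute a number that only depends on
  \<open>n mod 2 B\<close>.  The complexity is thus a finite sum of shifts of \<open>n \<mapsto> A(n div B)\<close> and an eventually
  periodic sequence.
\<close>

section \<open>Regular sequences\<close>

text \<open>The integers are Noetherian. By induction on the generators: the integers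
  \<open>a\<close> with \<open>a * g + h \<in> N\<close> for some \<open>h\<close> in the span of
  \<open>G\<close> form an ideal. An element of \<open>N\<close> realising its least positive
  member, together with generators of \<open>N \<inter> int_seq.span G\<close>, generates
  \<open>N\<close>; without a positive member, \<open>N\<close> already lies in the span of
  \<open>G\<close>.\<close>

lemma int_submodule_finitely_generated:
  assumes "finite G" "int_seq.subspace N" "N \<subseteq> int_seq.span G"
  shows "\<exists>H. finite H \<and> int_seq.span H = N"
  using assms
proof (induction G arbitrary: N rule: finite_induct)
  case empty
  have "0 \<in> N" using empty.prems(1) by (rule int_seq.subspace_0)
  then have "N = int_seq.span {}" using empty.prems(2) by auto
  then show ?case by blast
next
  case (insert g G)
  let ?I = "\<lambda>a. \<exists>h\<in>int_seq.span G. (\<lambda>n. a * g n) + h \<in> N"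
  note N = insert.prems(1)
  have decomp: "\<exists>a. x - (\<lambda>n. a * g n) \<in> int_seq.span G" if "x \<in> N" for x
    using that insert.prems(2) int_seq.span_breakdown_eq[of x g G] by auto
  have inter: "int_seq.subspace (N \<inter> int_seq.span G)"
    using N by (intro int_seq.subspace_inter int_seq.subspace_span)
  obtain H' where H': "finite H'" "int_seq.span H' = N \<inter> int_seq.span G"
    using insert.IH[OF inter] by blast
  show ?case
  proof (cases "\<exists>d>0. ?I (int d)")
    case False
    have "N \<subseteq> int_seq.span G"
    proof
      fix x assume x: "x \<in> N"
      then obtain a where a: "x - (\<lambda>n. a * g n) \<in> int_seq.span G" using decomp by blast
      have "?I a"
        using a x by (intro bexI[of _ "x - (\<lambda>n. a * g n)"]) auto
      moreover have "?I (- a)"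
        using int_seq.span_neg[OF a] int_seq.subspace_neg[OF N x]
        by (intro bexI[of _ "- (x - (\<lambda>n. a * g n))"]) (auto simp: fun_eq_iff fun_Compl_def plus_fun_def fun_diff_def)
      ultimately have I: "?I \<bar>a\<bar>" by (cases "a \<ge> 0") simp_all
      have "a = 0"
      proof (rule ccontr)
        assume "a \<noteq> 0"
        then have "nat \<bar>a\<bar> > 0" "int (nat \<bar>a\<bar>) = \<bar>a\<bar>" by auto
        then show False using False I by metis
      qed
      with a show "x \<in> int_seq.span G" by (simp add: fun_diff_def)
    qed
    then show ?thesis using H' by blast
  next
    case True
    define d where "d = (LEAST d. d > 0 \<and> ?I (int d))"
    have d: "d > 0" "?I (int d)" using LeastI_ex[OF True] unfolding d_def by auto
    have dmin: "d \<le> e" if "e > 0" "?I (int e)" for e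
      unfolding d_def using that by (intro Least_le) auto
    from d obtain h where h: "h \<in> int_seq.span G" "(\<lambda>n. int d * g n) + h \<in> N" by blast
    define x0 where "x0 = (\<lambda>n. int d * g n) + h"
    have "N \<subseteq> int_seq.span (insert x0 H')"
    proof
      fix x assume x: "x \<in> N"
      then obtain a where a: "x - (\<lambda>n. a * g n) \<in> int_seq.span G" using decomp by blast
      \<comment> \<open>Euclidean division: the coefficient left at \<open>g\<close> is
        \<open>a mod int d\<close>, which vanishes by minimality of \<open>d\<close>.\<close>
      define y where "y = x - (\<lambda>n. (a div int d) * x0 n)"
      have yN: "y \<in> N"
        unfolding y_def using N x h(2) unfolding x0_def[symmetric]
        by (intro int_seq.subspace_diff int_seq.subspace_scale)
      define z where "z = (x - (\<lambda>n. a * g n)) - (\<lambda>n. (a div int d) * h n)"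
      have z: "z \<in> int_seq.span G"
        unfolding z_def by (intro int_seq.span_diff int_seq.span_scale a h(1))
      have eq: "y = (\<lambda>n. (a mod int d) * g n) + z"
      proof
        fix n
        have "a * g n = (a div int d * int d + a mod int d) * g n" by simp
        also have "\<dots> = int d * (g n * (a div int d)) + g n * (a mod int d)"
          by (simp only: distrib_left distrib_right ac_simps)
        finally show "y n = ((\<lambda>n. (a mod int d) * g n) + z) n"
          unfolding y_def z_def x0_def by (simp add: algebra_simps)
      qed
      have "?I (a mod int d)" using eq yN z by (intro bexI[of _ z]) simp_all
      then have I: "?I (int (nat (a mod int d)))" using d(1) by simp
      have "a mod int d = 0"
      proof (rule ccontr)
        assume "a mod int d \<noteq> 0"
        then have "nat (a mod int d) > 0" using d(1) by (simp add: order_le_neq_trans)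
        then have "d \<le> nat (a mod int d)" using I by (rule dmin)
        moreover have "nat (a mod int d) < d" using d(1) by (simp add: nat_less_iff)
        ultimately show False by simp
      qed
      with eq have "y = z" by (simp add: fun_eq_iff)
      with yN z H' have "y \<in> int_seq.span H'" by auto
      then show "x \<in> int_seq.span (insert x0 H')"
        unfolding int_seq.span_breakdown_eq y_def by blast
    qed
    moreover have "int_seq.span (insert x0 H') \<subseteq> N"
    proof (rule int_seq.span_minimal[OF _ N])
      show "insert x0 H' \<subseteq> N" using h(2) H' int_seq.span_superset[of H'] unfolding x0_def by auto
    qed
    ultimately show ?thesis using H'(1) by (intro exI[of _ "insert x0 H'"]) auto
  qed
qed

section \<open>A sufficient criterion for regularity and its closure properties\<close>

definition stable_gens :: "nat \<Rightarrow> (nat \<Rightarrow> int) set \<Rightarrow> bool" where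
  "stable_gens b G \<longleftrightarrow> finite G \<and> (\<forall>g\<in>G. \<forall>r<b. (\<lambda>n. g (b * n + r)) \<in> int_seq.span G)"

definition representable :: "nat \<Rightarrow> (nat \<Rightarrow> int) \<Rightarrow> bool" where
  "representable b w \<longleftrightarrow> (\<exists>G. stable_gens b G \<and> w \<in> int_seq.span G)"

lemma stable_gens_span:
  assumes "stable_gens b G" "f \<in> int_seq.span G" "r < b"
  shows "(\<lambda>n. f (b * n + r)) \<in> int_seq.span G"
  using assms(2)
proof (induction f rule: int_seq.span_induct_alt)
  case base
  then show ?case using int_seq.span_zero[of G] by (simp add: zero_fun_def)
next
  case (step c x y)
  have "(\<lambda>n. c * x (b * n + r)) + (\<lambda>n. y (b * n + r)) \<in> int_seq.span G"
    using step assms unfolding stable_gens_def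
    by (intro int_seq.span_add int_seq.span_scale) auto
  then show ?case by (simp add: plus_fun_def)
qed

text \<open>It suffices to bound the kernel from above: its span is a submodule of the span of
  \<open>G\<close>, hence finitely generated as well.\<close>

lemma representable_regular:
  assumes "representable b w" "b > 0"
  shows "regular_seq b w"
proof -
  obtain G where G: "stable_gens b G" "w \<in> int_seq.span G"
    using assms unfolding representable_def by blast
  have ker: "(\<lambda>n. w (b ^ e * n + r)) \<in> int_seq.span G" if "r < b ^ e" for e r
    using that
  proof (induction e arbitrary: r)
    case 0
    then show ?case using G by simp
  next
    case (Suc e)
    have "r div b ^ e < b" using Suc.prems
      by (simp add: less_mult_imp_div_less mult.commute)
    moreover have "(\<lambda>n. w (b ^ e * n + r mod b ^ e)) \<in> int_seq.span G"
      using Suc.IH[of "r mod b ^ e"] assms by simp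
    \<comment> \<open>The leading digit of \<open>r\<close> in base \<open>b\<close> is absorbed by
      stability of the span, the other digits by the induction hypothesis.\<close>
    ultimately have "(\<lambda>n. w (b ^ e * (b * n + r div b ^ e) + r mod b ^ e)) \<in> int_seq.span G"
      using stable_gens_span[OF G(1)] by fastforce
    moreover have "b ^ e * (b * n + r div b ^ e) + r mod b ^ e = b ^ Suc e * n + r" for n
      by (simp add: distrib_left mult.assoc mult.left_commute add.assoc)
    ultimately show ?case by simp
  qed
  then have "kernel_seqs b w \<subseteq> int_seq.span G" unfolding kernel_seqs_def by blast
  then have "int_seq.span (kernel_seqs b w) \<subseteq> int_seq.span G"
    by (simp add: int_seq.span_minimal)
  then show ?thesis
    using int_submodule_finitely_generated[of G "int_seq.span (kernel_seqs b w)"] G(1)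
    unfolding regular_seq_def stable_gens_def by auto
qed

lemma representable_add:
  assumes "representable b v" "representable b w"
  shows "representable b (\<lambda>n. v n + w n)"
proof -
  obtain G H where G: "stable_gens b G" "v \<in> int_seq.span G"
    and H: "stable_gens b H" "w \<in> int_seq.span H"
    using assms unfolding representable_def by blast
  have mono: "int_seq.span G \<subseteq> int_seq.span (G \<union> H)" "int_seq.span H \<subseteq> int_seq.span (G \<union> H)"
    by (auto intro!: int_seq.span_mono)
  have "stable_gens b (G \<union> H)"
    using G H mono unfolding stable_gens_def by blast
  moreover have "v + w \<in> int_seq.span (G \<union> H)"
    using G H mono by (intro int_seq.span_add) auto
  ultimately show ?thesis unfolding representable_def by (auto simp: plus_fun_def)
qed

lemma representable_zero: "representable b (\<lambda>n. 0)"
  unfolding representable_def stable_gens_def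
  by (intro exI[of _ "{}"]) (simp add: zero_fun_def)

lemma representable_sum:
  assumes "finite S" "\<And>s. s \<in> S \<Longrightarrow> representable b (f s)"
  shows "representable b (\<lambda>n. \<Sum>s\<in>S. f s n)"
  using assms by (induction S rule: finite_induct) (auto intro: representable_zero representable_add)

lemma mod_unique_in_period:
  fixes x y :: nat
  assumes "x mod p = y mod p" "x \<in> {n0..<n0+p}" "y \<in> {n0..<n0+p}"
  shows "x = y"
  using assms
proof (induction x y rule: linorder_wlog)
  case (le x y)
  then have "p dvd y - x" by (metis mod_eq_dvd_iff_nat)
  moreover have "y - x < p" using le by auto
  ultimately show ?case using le by (metis diff_is_0_eq dual_order.antisym nat_dvd_not_less neq0_conv)
qed auto

text \<open>The sequences with period \<open>p\<close> from \<open>n0\<close> on are spanned by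
  \<open>n0 + p\<close> indicator sequences. Their module is stable, since replacing
  \<open>n\<close> by \<open>n + p\<close> changes \<open>b * n + r\<close> by a multiple of
  \<open>p\<close>.\<close>

lemma representable_eventually_periodic:
  assumes per: "\<And>n. n \<ge> n0 \<Longrightarrow> f (n + p) = f n" and "b > 0" "p > 0"
  shows "representable b f"
proof -
  define e where "e a = (\<lambda>n. if n = a then 1 else 0 :: int)" for a :: nat
  define e' where "e' a = (\<lambda>n. if n \<ge> n0 \<and> n mod p = a mod p then 1 else 0 :: int)" for a :: nat
  define G where "G = e ` {..<n0} \<union> e' ` {n0..<n0+p}"
  have span: "h \<in> int_seq.span G" if h: "\<And>n. n \<ge> n0 \<Longrightarrow> h (n + p) = h n" for h
  proof -
    have hmod: "h (n + k * p) = h n" if "n \<ge> n0" for n k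
    proof (induction k)
      case (Suc k)
      then show ?case using h[of "n + k * p"] that by (simp add: ac_simps)
    qed simp
    have "(\<Sum>a<n0. (\<lambda>n. h a * e a n)) + (\<Sum>a\<in>{n0..<n0+p}. (\<lambda>n. h a * e' a n)) \<in> int_seq.span G"
      by (intro int_seq.span_add int_seq.span_sum int_seq.span_scale int_seq.span_base)
        (auto simp: G_def)
    also have "(\<Sum>a<n0. (\<lambda>n. h a * e a n)) + (\<Sum>a\<in>{n0..<n0+p}. (\<lambda>n. h a * e' a n)) = h"
    proof
      fix n
      have sum_app: "(\<Sum>a\<in>S. F a) n = (\<Sum>a\<in>S. F a n)" if "finite S"
        for S :: "nat set" and F :: "nat \<Rightarrow> nat \<Rightarrow> int"
        using that by (induction S rule: finite_induct) auto
      show "((\<Sum>a<n0. (\<lambda>n. h a * e a n)) + (\<Sum>a\<in>{n0..<n0+p}. (\<lambda>n. h a * e' a n))) n = h n"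
      proof (cases "n < n0")
        case True
        then show ?thesis by (simp add: sum_app e_def e'_def if_distrib[of "(*) _"] cong: if_cong)
      next
        case False
        define a where "a = n0 + (n - n0) mod p"
        have a: "a \<in> {n0..<n0+p}" "n = a + (n - n0) div p * p"
          using False \<open>p > 0\<close> by (auto simp: a_def)
        have uniq: "a' mod p = n mod p \<longleftrightarrow> a' = a" if "a' \<in> {n0..<n0+p}" for a'
        proof
          assume "a' mod p = n mod p"
          then have "a' mod p = a mod p" using a(2) by (metis mod_mult_self1)
          then show "a' = a" using a(1) that mod_unique_in_period by blast
        next
          assume "a' = a"
          then show "a' mod p = n mod p" using a(2) by (metis mod_mult_self1)
        qed
        have "(\<Sum>a'\<in>{n0..<n0+p}. h a' * e' a' n) = (\<Sum>a'\<in>{n0..<n0+p}. if a' = a then h a' else 0)"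
          using False uniq by (intro sum.cong refl) (simp add: e'_def eq_commute[of "n mod p"])
        also have "\<dots> = h a" using a by simp
        also have "h a = h n" using a hmod[of a "(n - n0) div p"] by simp
        finally have "(\<Sum>a'\<in>{n0..<n0+p}. h a' * e' a' n) = h n" .
        moreover have "(\<Sum>a<n0. h a * e a n) = 0" using False by (intro sum.neutral) (auto simp: e_def)
        ultimately show ?thesis by (simp add: sum_app)
      qed
    qed
    finally show ?thesis .
  qed
  have closed: "g (b * (n + p) + r) = g (b * n + r)"
    if "\<And>n. n \<ge> n0 \<Longrightarrow> g (n + p) = g n" "n \<ge> n0" for g :: "nat \<Rightarrow> int" and n r
  proof -
    have "g (b * n + r + k * p) = g (b * n + r)" for k
    proof (induction k)
      case (Suc k)
      have "b * n + r + k * p \<ge> n0" using that(2) \<open>b > 0\<close>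
        by (metis One_nat_def Suc_leI add.commute le_add2 le_trans mult_le_mono1 nat_mult_1 trans_le_add1)
      then show ?case using Suc that(1)[of "b * n + r + k * p"] by (simp add: ac_simps)
    qed simp
    from this[of b] show ?thesis by (simp add: algebra_simps)
  qed
  have "g (n + p) = g n" if "g \<in> G" "n \<ge> n0" for g n
    using that \<open>p > 0\<close> by (auto simp: G_def e_def e'_def)
  then have "(\<lambda>n. g (b * n + r)) \<in> int_seq.span G" if "g \<in> G" for g r
    using closed that by (intro span) blast
  then have "stable_gens b G"
    unfolding stable_gens_def by (simp add: G_def)
  then show ?thesis unfolding representable_def using span[of f] per by blast
qed

section \<open>The Cantor sequence and its ones\<close>

lemma cantor_01: "cantor n = 0 \<or> cantor n = 1"
proof (induction n rule: less_induct)
  case (less n)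
  show ?case
    using less[of "n div 3"] by (subst (1 2) cantor.simps) auto
qed

lemma cantor_le_1: "cantor n \<le> 1"
  using cantor_01[of n] by auto

lemma cantor_small: "cantor 0 = 1" "cantor 1 = 0" "cantor 2 = 1" "cantor 3 = 0"
  using cantor_rec(1) cantor_rec(3)[of 0] cantor_rec(4)[of 0] cantor_rec(2)[of 1] by (simp_all add: numeral_2_eq_2)

lemma cantor_digit: "cantor (3 * n + r) = cantor n * cantor r" if "r < 3"
proof -
  have "r = 0 \<or> r = 1 \<or> r = 2" using that by auto
  then show ?thesis using cantor_rec(2-4)[of n] cantor_small by auto
qed

text \<open>A letter is the product of the letters at the ternary digits of its index, so cutting
  off the last \<open>m\<close> digits splits the product. Aligned blocks of length
  \<open>3 ^ m\<close> are thus zero or copies of the first one.\<close>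

lemma cantor_block: "r < 3 ^ m \<Longrightarrow> cantor (3 ^ m * q + r) = cantor q * cantor r"
proof (induction m arbitrary: r)
  case 0
  then show ?case by (simp add: cantor_small)
next
  case (Suc m)
  have "r div 3 < 3 ^ m" using Suc.prems by auto
  note IH = Suc.IH[OF this]
  have eq: "3 ^ Suc m * q + r = 3 * (3 ^ m * q + r div 3) + r mod 3" by simp
  have "cantor (3 ^ Suc m * q + r) = cantor (3 ^ m * q + r div 3) * cantor (r mod 3)"
    unfolding eq by (rule cantor_digit) simp
  also have "\<dots> = cantor q * (cantor (r div 3) * cantor (r mod 3))" using IH by simp
  also have "cantor (r div 3) * cantor (r mod 3) = cantor r"
    using cantor_digit[of "r mod 3" "r div 3"] by simp
  finally show ?case .
qed

lemma cantor_div_block: "cantor y = 1 \<Longrightarrow> cantor (y div 3 ^ m) = 1"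
  using cantor_block[of "y mod 3 ^ m" m "y div 3 ^ m"] by simp

text \<open>A number has the parity of its ternary digit sum, so an odd number has a digit
  1.\<close>

lemma cantor_odd: "odd n \<Longrightarrow> cantor n = 0"
proof (induction n rule: less_induct)
  case (less n)
  have "odd (n div 3)" if "n mod 3 \<noteq> 1" using that less.prems by presburger
  then show ?case using less by (subst cantor.simps) (auto simp: odd_pos)
qed

lemma cantor_even: "cantor n = 1 \<Longrightarrow> even n"
  using cantor_odd by fastforce

lemma cantor_Suc: "cantor n = 1 \<Longrightarrow> cantor (Suc n) = 0"
  using cantor_even cantor_odd by simp

text \<open>Complementing the \<open>h\<close> ternary digits, \<open>d \<mapsto> 2 - d\<close>,
  preserves the absence of the digit 1.\<close>

lemma cantor_mirror: "z < 3 ^ h \<Longrightarrow> cantor (3 ^ h - 1 - z) = cantor z"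
proof (induction h arbitrary: z)
  case 0
  then show ?case by simp
next
  case (Suc h)
  have lt: "z div 3 < 3 ^ h" using Suc.prems by auto
  have lt2: "z mod 3 < 3" by simp
  have eq: "3 ^ Suc h - 1 - z = 3 * (3 ^ h - 1 - z div 3) + (2 - z mod 3)"
  proof -
    have "z = 3 * (z div 3) + z mod 3" by simp
    then show ?thesis using lt lt2 unfolding power_Suc by linarith
  qed
  have "cantor (3 ^ Suc h - 1 - z) = cantor (z div 3) * cantor (2 - z mod 3)"
    unfolding eq Suc.IH[OF lt, symmetric] by (rule cantor_digit) simp
  moreover have "cantor (2 - z mod 3) = cantor (z mod 3)"
  proof -
    have "z mod 3 = 0 \<or> z mod 3 = 1 \<or> z mod 3 = 2" by auto
    then show ?thesis using cantor_small by auto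
  qed
  ultimately show ?case using cantor_digit[of "z mod 3" "z div 3"] by simp
qed

lemma cantor_pow_minus_1: "cantor (3 ^ m - 1) = 1"
  using cantor_mirror[of 0 m] cantor_small by simp

text \<open>The distance is expanded in base 3 with digits \<open>-2\<close>, \<open>0\<close>,
  \<open>2\<close>; the digit \<open>-2\<close> causes the carry to \<open>K' + 1\<close>. The bound
  \<open>b \<ge> 1\<close> leaves room for a word that starts before the block with index
  \<open>b\<close>.\<close>

lemma cantor_distances: "\<exists>b\<ge>1. cantor b = 1 \<and> cantor (b + 2 * K) = 1"
proof (induction K rule: less_induct)
  case (less K)
  consider "K = 0" | K' where "K = 3 * K'" "K' > 0" | K' where "K = 3 * K' + 1"
    | K' where "K = 3 * K' + 2"
  proof -
    have "K = 3 * (K div 3) + K mod 3" "K mod 3 = 0 \<or> K mod 3 = 1 \<or> K mod 3 = 2" by auto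
    then show ?thesis using that by (metis add.right_neutral gr0I mult_0_right)
  qed
  then show ?case
  proof cases
    case 1
    then show ?thesis by (intro exI[of _ 2]) (simp add: cantor_small)
  next
    case 2
    then obtain b where b: "b \<ge> 1" "cantor b = 1" "cantor (b + 2 * K') = 1"
      using less[of K'] by auto
    then show ?thesis using cantor_rec(2)[of b] cantor_rec(2)[of "b + 2 * K'"] 2
      by (intro exI[of _ "3 * b"]) (auto simp: algebra_simps)
  next
    case 3
    then obtain b where b: "b \<ge> 1" "cantor b = 1" "cantor (b + 2 * K') = 1"
      using less[of K'] by auto
    then show ?thesis using cantor_rec(2)[of b] cantor_rec(4)[of "b + 2 * K'"] 3
      by (intro exI[of _ "3 * b"]) (auto simp: algebra_simps)
  next
    case 4
    then obtain b where b: "b \<ge> 1" "cantor b = 1" "cantor (b + 2 * (K' + 1)) = 1"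
      using less[of "K' + 1"] by auto
    have "3 * b + 2 + 2 * K = 3 * (b + 2 * (K' + 1))" using 4 by simp
    then show ?thesis using cantor_rec(4)[of b] cantor_rec(2)[of "b + 2 * (K' + 1)"] b
      by (intro exI[of _ "3 * b + 2"]) auto
  qed
qed

section \<open>The number of ones in a prefix of the sequence\<close>

definition ones :: "nat \<Rightarrow> nat" where
  "ones n = (\<Sum>j<n. cantor j)"

lemma ones_0 [simp]: "ones 0 = 0"
  by (simp add: ones_def)

lemma ones_Suc: "ones (Suc n) = ones n + cantor n"
  by (simp add: ones_def)

lemma ones_mono: "a \<le> b \<Longrightarrow> ones a \<le> ones b"
  unfolding ones_def by (intro sum_mono2) auto

lemma ones_less: "cantor a = 1 \<Longrightarrow> a < b \<Longrightarrow> ones a < ones b"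
  using ones_mono[of "Suc a" b] by (simp add: ones_Suc)

lemma ones_add: "ones (a + d) = ones a + (\<Sum>j<d. cantor (a + j))"
  by (induction d) (simp_all add: ones_Suc)

lemma ones_rec:
  "ones (3 * n) = 2 * ones n"
  "ones (3 * n + 1) = ones n + ones (Suc n)"
  "ones (3 * n + 2) = ones n + ones (Suc n)"
proof -
  show A: "ones (3 * n) = 2 * ones n"
  proof (induction n)
    case (Suc n)
    have eq: "3 * Suc n = Suc (Suc (Suc (3 * n)))" by simp
    have "ones (3 * Suc n) = ones (3 * n) + cantor (3 * n) + cantor (3 * n + 1) + cantor (3 * n + 2)"
      unfolding eq by (simp add: ones_Suc)
    then show ?case using Suc cantor_rec(2-4)[of n] by (simp add: ones_Suc)
  qed simp
  show B: "ones (3 * n + 1) = ones n + ones (Suc n)"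
    using A cantor_rec(2)[of n] ones_Suc[of "3 * n"] ones_Suc[of n] by simp
  show "ones (3 * n + 2) = ones n + ones (Suc n)"
    using B cantor_rec(3)[of n] ones_Suc[of "3 * n + 1"] by simp
qed

text \<open>Induction through the ternary recursion of \<open>ones\<close>. The delicate case is
  that both last digits are 2, where simply adding two induction hypotheses can exceed the
  bound.\<close>

lemma ones_subadd: "ones (x + y) \<le> ones x + ones y"
proof (induction "x + y" arbitrary: x y rule: less_induct)
  case less
  show ?case
  proof (cases "x = 0 \<or> y = 0")
    case True
    then show ?thesis by auto
  next
    case False
    define p r q s where defs: "p = x div 3" "r = x mod 3" "q = y div 3" "s = y mod 3"
    have x: "x = 3 * p + r" and y: "y = 3 * q + s" by (simp_all add: defs)
    have rs: "r = 0 \<or> r = 1 \<or> r = 2" "s = 0 \<or> s = 1 \<or> s = 2" by (auto simp: defs)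
    note IH = less(1)
    have a: "ones (p + q) \<le> ones p + ones q" using IH[of p q] False x y by auto
    have b: "ones (Suc (p + q)) \<le> ones (Suc p) + ones q" if "r > 0 \<or> s > 0"
      using IH[of "Suc p" q] that False x y by auto
    have c: "ones (Suc (p + q)) \<le> ones p + ones (Suc q)" if "r > 0 \<or> s > 0"
      using IH[of p "Suc q"] that False x y by auto
    have mono: "ones p \<le> ones (Suc p)" "ones q \<le> ones (Suc q)" by (auto intro: ones_mono)
    have d: "ones (Suc (p + q)) + ones (Suc (Suc (p + q)))
      \<le> ones p + ones (Suc p) + (ones q + ones (Suc q))" if "r = 2" "s = 2"
    proof -
      have IH': "ones (Suc (Suc (p + q))) \<le> ones (Suc p) + ones (Suc q)"
        using IH[of "Suc p" "Suc q"] that x y by auto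
      have c2: "ones (Suc (p + q)) \<le> ones p + ones (Suc q)" "ones (Suc (p + q)) \<le> ones (Suc p) + ones q"
        using b c that by auto
      show ?thesis
      \<comment> \<open>If \<open>p\<close> and \<open>q\<close> carry ones, both are even, so
        \<open>p + q + 1\<close> carries none and the two mixed bounds in \<open>c2\<close> suffice.
        Otherwise one of these bounds improves to \<open>ones p + ones q\<close>.\<close>
      proof (cases "cantor p = 1 \<and> cantor q = 1")
        case True
        then have "cantor (Suc (p + q)) = 0" using cantor_even by (auto intro!: cantor_odd)
        then have "ones (Suc (Suc (p + q))) = ones (Suc (p + q))" by (simp add: ones_Suc)
        then show ?thesis using c2 by linarith
      next
        case False
        then have "ones (Suc p) = ones p \<or> ones (Suc q) = ones q"
          using cantor_01[of p] cantor_01[of q] by (auto simp: ones_Suc)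
        then show ?thesis using c2 IH' by auto
      qed
    qed
    have sumeq: "x + y = 3 * (p + q) + (r + s)" using x y by simp
    have eq3: "3 * Suc (p + q) = Suc (Suc (Suc (3 * p + 3 * q)))" by simp
    note o3 = ones_rec(1,2)[of "Suc (p + q)", unfolded eq3]
    show ?thesis
      using rs a b c d mono ones_rec[of p] ones_rec[of q] ones_rec[of "p + q"] o3 unfolding sumeq x y
      by (elim disjE) (simp_all)
  qed
qed

text \<open>\<open>ones\<close> grows by at most one per step, so no value is skipped, and the step
  that first reaches \<open>v\<close> passes a one.\<close>

lemma ones_reaches:
  assumes "v \<le> ones n" "v > 0"
  obtains y where "y < n" "cantor y = 1" "ones (Suc y) = v"
proof -
  define z where "z = (LEAST z. v \<le> ones z)"
  have z: "v \<le> ones z" "z \<le> n" unfolding z_def using assms by (auto intro: LeastI Least_le)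
  have "z \<noteq> 0" using z(1) assms(2) by (metis ones_0 leD)
  then obtain y where y: "z = Suc y" by (cases z) auto
  have "\<not> v \<le> ones y" using y not_less_Least[of y "\<lambda>z. v \<le> ones z"] unfolding z_def by auto
  then have "cantor y = 1" "ones (Suc y) = v"
    using z(1) y cantor_le_1[of y] by (auto simp: ones_Suc)
  then show ?thesis using that[of y] y z(2) by auto
qed

lemma ones_shift_pow: "y \<le> 3 ^ h \<Longrightarrow> ones (2 * 3 ^ h + y) = ones (2 * 3 ^ h) + ones y"
proof -
  assume "y \<le> 3 ^ h"
  then have "(\<Sum>j<y. cantor (2 * 3 ^ h + j)) = ones y"
    unfolding ones_def using cantor_block[of _ h 2] cantor_small
    by (intro sum.cong) (auto simp: mult.commute)
  then show ?thesis by (simp add: ones_add)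
qed

lemma ones_mirror: "y \<le> 3 ^ h \<Longrightarrow> ones (3 ^ h) = ones (3 ^ h - y) + ones y"
proof (induction y)
  case (Suc y)
  have "3 ^ h - y = Suc (3 ^ h - Suc y)" using Suc.prems by simp
  then have "ones (3 ^ h - y) = ones (3 ^ h - Suc y) + cantor (3 ^ h - 1 - y)"
    by (simp add: ones_Suc)
  then show ?case using Suc cantor_mirror[of y h] by (simp add: ones_Suc)
qed simp

lemma ones_zero_block:
  assumes "3 ^ h \<le> y" "y \<le> 2 * 3 ^ h"
  shows "ones y = ones (3 ^ h)"
proof -
  have "(\<Sum>j<y - 3 ^ h. cantor (3 ^ h + j)) = 0"
    using assms cantor_block[of _ h 1] cantor_small by (intro sum.neutral) auto
  then show ?thesis using ones_add[of "3 ^ h" "y - 3 ^ h"] assms by simp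
qed

lemma cantor_cases:
  assumes "cantor x = 1"
  obtains z i where "x = 3 * z + 2 * i" "i \<le> 1" "cantor z = 1" "ones x = 2 * ones z + i"
proof -
  have "x = 3 * (x div 3) + x mod 3" "x mod 3 = 0 \<or> x mod 3 = 1 \<or> x mod 3 = 2" by auto
  then consider z where "x = 3 * z" | z where "x = 3 * z + 1" | z where "x = 3 * z + 2"
    by (metis add.right_neutral)
  then show ?thesis
  proof cases
    case (1 z)
    then show ?thesis using that[of z 0] assms cantor_rec(2)[of z] ones_rec(1)[of z] by simp
  next
    case (2 z)
    then show ?thesis using assms cantor_rec(3)[of z] by simp
  next
    case (3 z)
    have "cantor z = 1" using 3 assms cantor_rec(4)[of z] by simp
    moreover have "ones x = 2 * ones z + 1"
      using 3 ones_rec(3)[of z] \<open>cantor z = 1\<close> unfolding ones_Suc[of z] by simp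
    ultimately show ?thesis using that[of z 1] 3 by simp
  qed
qed

text \<open>The indices of the ones have ternary digits in \<open>{0, 2}\<close>, so half the sum of two of
  them is computed without carries, and determines the sum of the values of \<^const>\<open>ones\<close>.\<close>

lemma ones_rigid:
  assumes "cantor x = 1" "cantor y = 1" "cantor x' = 1" "cantor y' = 1" "x + y = x' + y'"
  shows "ones x + ones y = ones x' + ones y'"
  using assms
proof (induction "x + y" arbitrary: x y x' y' rule: less_induct)
  case less
  show ?case
  proof (cases "x + y = 0")
    case True
    then show ?thesis using less.prems(5) by simp
  next
    case False
    have IH: "ones a + ones b = ones a' + ones b'"
      if "a + b < x + y" "cantor a = 1" "cantor b = 1" "cantor a' = 1" "cantor b' = 1" "a + b = a' + b'"
      for a b a' b'
      using less.hyps[of a b a' b'] that by blast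
    obtain a i where a: "x = 3 * a + 2 * i" "i \<le> 1" "cantor a = 1" "ones x = 2 * ones a + i"
      by (rule cantor_cases[OF less.prems(1)])
    obtain b j where b: "y = 3 * b + 2 * j" "j \<le> 1" "cantor b = 1" "ones y = 2 * ones b + j"
      by (rule cantor_cases[OF less.prems(2)])
    obtain a' i' where a': "x' = 3 * a' + 2 * i'" "i' \<le> 1" "cantor a' = 1" "ones x' = 2 * ones a' + i'"
      by (rule cantor_cases[OF less.prems(3)])
    obtain b' j' where b': "y' = 3 * b' + 2 * j'" "j' \<le> 1" "cantor b' = 1" "ones y' = 2 * ones b' + j'"
      by (rule cantor_cases[OF less.prems(4)])
    have eq: "3 * (a + b) + 2 * (i + j) = 3 * (a' + b') + 2 * (i' + j')"
      using less.prems(5) a(1) b(1) a'(1) b'(1) by simp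
    \<comment> \<open>As 2 is invertible modulo 3 and both digit sums are at most 2, equal residues
      force equal sums.\<close>
    have "2 * (i + j) mod 3 = 2 * (i' + j') mod 3"
      using arg_cong[OF eq, of "\<lambda>x. x mod 3"] by (simp only: mod_mult_self4)
    moreover have "i + j = 0 \<or> i + j = 1 \<or> i + j = 2" "i' + j' = 0 \<or> i' + j' = 1 \<or> i' + j' = 2"
      using a(2) b(2) a'(2) b'(2) by auto
    ultimately have "i + j = i' + j'" by (elim disjE) (simp_all only:, simp_all)
    with eq have "a + b = a' + b'" by simp
    moreover have "a + b < x + y" using False a(1) b(1) by linarith
    ultimately have "ones a + ones b = ones a' + ones b'"
      using IH[of a b a' b'] a(3) b(3) a'(3) b'(3) by blast
    then show ?thesis using a(4) b(4) a'(4) b'(4) \<open>i + j = i' + j'\<close> by linarith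
  qed
qed

text \<open>\<open>nat\<close> extends \<open>ones\<close> by zero to negative arguments, and the
  recursions persist there, even at \<open>x = -1\<close>. Negative shifts thus need no separate
  treatment.\<close>

lemma ones_rec_int:
  fixes x :: int
  shows "int (ones (nat (3 * x))) = 2 * int (ones (nat x))"
    "int (ones (nat (3 * x + 1))) = int (ones (nat x)) + int (ones (nat (x + 1)))"
    "int (ones (nat (3 * x + 2))) = int (ones (nat x)) + int (ones (nat (x + 1)))"
proof -
  have pos: "nat (3 * x) = 3 * nat x" "nat (3 * x + 1) = 3 * nat x + 1"
    "nat (3 * x + 2) = 3 * nat x + 2" "nat (x + 1) = Suc (nat x)" if "x \<ge> 0"
    using that by auto
  have neg: "nat (3 * x) = 0" "nat (3 * x + 1) = 0" "nat (3 * x + 2) = 0" "nat (x + 1) = 0" "nat x = 0"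
    if "x < 0" using that by auto
  show "int (ones (nat (3 * x))) = 2 * int (ones (nat x))"
    "int (ones (nat (3 * x + 1))) = int (ones (nat x)) + int (ones (nat (x + 1)))"
    "int (ones (nat (3 * x + 2))) = int (ones (nat x)) + int (ones (nat (x + 1)))"
    by (cases "x < 0"; simp only: neg pos not_less ones_rec ones_0; simp)+
qed

text \<open>Substituting \<open>3 * n + r\<close> lowers the exponent \<open>j\<close> until it is
  0, and then the recursion of \<open>ones\<close> produces two neighbouring shifts. The shifts stay
  bounded, so finitely many sequences \<open>f j a\<close> suffice.\<close>

lemma representable_ones:
  fixes c :: int
  shows "representable 3 (\<lambda>n. int (ones (nat ((int n + c) div 3 ^ i))))"
proof -
  define f where "f j c = (\<lambda>n. int (ones (nat ((int n + c) div 3 ^ j))))" for j :: nat and c :: int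
  \<comment> \<open>A bound of at least 2 is preserved by passing from \<open>a\<close> to
    \<open>(r + a) div 3 + 1\<close> with \<open>r < 3\<close>.\<close>
  define C where "C = max 2 \<bar>c\<bar>"
  define G where "G = (\<lambda>(j, c). f j c) ` ({..i} \<times> {-C..C})"
  have C: "C \<ge> 2" by (simp add: C_def)
  have base: "f j a \<in> int_seq.span G" if "j \<le> i" "-C \<le> a" "a \<le> C" for j a
    using that by (intro int_seq.span_base) (auto simp: G_def)
  have "(\<lambda>n. f j a (3 * n + r)) \<in> int_seq.span G"
    if j: "j \<le> i" and a: "-C \<le> a" "a \<le> C" and r: "r < 3" for j a r
  proof -
    define a' where "a' = (int r + a) div 3"
    define s where "s = (int r + a) mod 3"
    have a': "-C \<le> a'" "a' + 1 \<le> C" using a r C unfolding a'_def by linarith+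
    have eq: "int (3 * n + r) + a = 3 * (int n + a') + s" for n
      unfolding a'_def s_def by simp
    have s: "s = 0 \<or> s = 1 \<or> s = 2" unfolding s_def by auto
    show ?thesis
    proof (cases j)
      case 0
      have "f j a (3 * n + r) = (if s = 0 then 2 * f 0 a' n else f 0 a' n + f 0 (a' + 1) n)" for n
        using s ones_rec_int[of "int n + a'"] unfolding f_def 0 eq by (auto simp: add.assoc)
      then have "(\<lambda>n. f j a (3 * n + r)) =
        (if s = 0 then (\<lambda>n. 2 * f 0 a' n) else f 0 a' + f 0 (a' + 1))"
        by (auto simp: fun_eq_iff)
      also have "\<dots> \<in> int_seq.span G"
        using a' by (auto intro!: int_seq.span_add int_seq.span_scale base)
      finally show ?thesis .
    next
      case (Suc j')
      have "(int (3 * n + r) + a) div 3 ^ j = (int n + a') div 3 ^ j'" for n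
      proof -
        have "(int (3 * n + r) + a) div 3 ^ j = ((int (3 * n + r) + a) div 3) div 3 ^ j'"
          unfolding Suc power_Suc by (rule zdiv_zmult2_eq) simp
        also have "(int (3 * n + r) + a) div 3 = int n + a'"
          unfolding eq using s by auto
        finally show ?thesis .
      qed
      then have "(\<lambda>n. f j a (3 * n + r)) = f j' a'" by (simp add: f_def)
      then show ?thesis using base[of j' a'] j a' Suc by simp
    qed
  qed
  then have "stable_gens 3 G" unfolding stable_gens_def by (auto simp: G_def)
  moreover have "f i c \<in> int_seq.span G" by (rule base) (auto simp: C_def)
  ultimately show ?thesis unfolding representable_def f_def by blast
qed

section \<open>Windows and their states\<close>

definition win :: "nat \<Rightarrow> nat \<Rightarrow> nat list" where
  "win k i = map cantor [i..<i + k]"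

lemma length_win [simp]: "length (win k i) = k"
  by (simp add: win_def)

lemma nth_win: "y < k \<Longrightarrow> win k i ! y = cantor (i + y)"
  by (simp add: win_def)

lemma win_eq_iff: "win k i = win k j \<longleftrightarrow> (\<forall>y<k. cantor (i + y) = cantor (j + y))"
  by (simp add: list_eq_iff_nth_eq nth_win)

lemma win_eq_zero_iff: "win k i = replicate k 0 \<longleftrightarrow> (\<forall>y<k. cantor (i + y) = 0)"
  by (simp add: list_eq_iff_nth_eq nth_win)

lemma ones_const:
  assumes "a \<le> b" "\<And>q. a \<le> q \<Longrightarrow> q < b \<Longrightarrow> cantor q = 0"
  shows "ones b = ones a"
proof -
  have "(\<Sum>j<b - a. cantor (a + j)) = 0" using assms by (intro sum.neutral) auto
  then show ?thesis using ones_add[of a "b - a"] assms(1) by simp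
qed

lemma ones_inj: "cantor x = 1 \<Longrightarrow> cantor y = 1 \<Longrightarrow> ones x = ones y \<Longrightarrow> x = y"
  using ones_less[of x y] ones_less[of y x] by (cases x y rule: linorder_cases) auto

text \<open>Occurrences in a factor are differences of these prefix counts. Predicates instead of
  words also cover combined counts, such as the number of ones.\<close>

definition cnt :: "nat \<Rightarrow> (nat list \<Rightarrow> bool) \<Rightarrow> nat \<Rightarrow> nat" where
  "cnt k Q i = (\<Sum>y<i. of_bool (Q (win k y)))"

lemma cnt_0 [simp]: "cnt k Q 0 = 0"
  by (simp add: cnt_def)

lemma cnt_Suc: "cnt k Q (Suc i) = cnt k Q i + of_bool (Q (win k i))"
  by (simp add: cnt_def)

lemma cnt_add: "cnt k Q (a + d) = cnt k Q a + (\<Sum>j<d. of_bool (Q (win k (a + j))))"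
  by (induction d) (simp_all add: cnt_Suc)

lemma cnt_hd: "cnt (Suc k) (\<lambda>w. hd w = 1) i = ones i"
proof -
  have "(of_bool (hd (win (Suc k) y) = 1) :: nat) = cantor y" for y
    using cantor_01[of y] by (auto simp: win_def upt_conv_Cons simp del: upt_Suc)
  then show ?thesis by (simp add: cnt_def ones_def)
qed

section \<open>Nonzero blocks and the states of positions\<close>

locale cantor_window =
  fixes l m :: nat
  assumes l_le: "l \<le> 3 ^ m" and l_gt: "m = 0 \<or> 3 ^ (m - 1) < l"
begin

definition B :: nat where "B = 3 ^ m"

lemma B_pos [simp]: "B > 0"
  by (simp add: B_def)

lemma l_le_B: "l \<le> B"
  using l_le by (simp add: B_def)

lemma cantor_B: "r < B \<Longrightarrow> cantor (B * q + r) = cantor q * cantor r"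
  unfolding B_def by (rule cantor_block)

text \<open>The word at \<open>[i, i + l)\<close> meets the nonzero block \<open>[B * b, B * b + B)\<close>, and ends
  at distance \<open>g\<close> from the start of this block.  The block is unique, and \<open>g\<close> is called the state
  of \<open>i\<close>; it is \<open>0\<close> if no such block exists.\<close>

definition meets :: "nat \<Rightarrow> nat \<Rightarrow> nat \<Rightarrow> bool" where
  "meets b g i \<longleftrightarrow> cantor b = 1 \<and> 0 < g \<and> g < B + l \<and> i + l = B * b + g"

text \<open>Ones are never adjacent, so distinct nonzero blocks start at least \<open>2 * B\<close>
  apart, while \<open>g < B + l \<le> 2 * B\<close>.\<close>

lemma meets_unique:
  assumes "meets b g i" "meets b' g' i"
  shows "b = b'" "g = g'"
proof -
  have no: "\<not> b < b'" if "meets b g i" "meets b' g' i" for b g b' g'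
  proof
    assume "b < b'"
    moreover have "b' \<noteq> Suc b" using that cantor_Suc[of b] by (auto simp: meets_def)
    ultimately have "b + 2 \<le> b'" by simp
    then have "B * (b + 2) \<le> B * b'" by (rule mult_le_mono2)
    then show False using that l_le_B by (auto simp: meets_def algebra_simps)
  qed
  show "b = b'" using no[OF assms] no[OF assms(2,1)] by simp
  then show "g = g'" using assms by (simp add: meets_def)
qed

definition st :: "nat \<Rightarrow> nat" where
  "st i = (if \<exists>b g. meets b g i then THE g. \<exists>b. meets b g i else 0)"

lemma st_eq: "meets b g i \<Longrightarrow> st i = g"
  unfolding st_def by (auto intro!: the_equality dest: meets_unique)

lemma st_pos:
  assumes "st i > 0"
  obtains b where "meets b (st i) i"
proof -
  have "\<exists>b g. meets b g i" using assms by (auto simp: st_def split: if_splits)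
  then show thesis using st_eq that by metis
qed

lemma st_zero_iff: "st i = 0 \<longleftrightarrow> (\<forall>b g. \<not> meets b g i)"
proof -
  have "st i = g \<and> g > 0" if "meets b g i" for b g
    using that st_eq by (auto simp: meets_def)
  moreover have "st i = 0" if "\<nexists>b g. meets b g i" using that by (simp add: st_def)
  ultimately show ?thesis by (metis less_irrefl)
qed

lemma st_less: "st i < B + l"
proof (cases "st i = 0")
  case False
  then obtain b where "meets b (st i) i" using st_pos by blast
  then show ?thesis by (simp add: meets_def)
qed simp

text \<open>The number of nonzero blocks that lie entirely before position \<open>i\<close>.\<close>

definition blocks :: "nat \<Rightarrow> nat" where
  "blocks i = ones (i div B)"

text \<open>Position \<open>i\<close> lies in block \<open>b\<close> itself or in its predecessor,
  which is a zero block.\<close>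

lemma blocks_meets:
  assumes "meets b g i"
  shows "blocks i = ones b"
proof (cases "g \<ge> l")
  case True
  then have "i = B * b + (g - l)" "g - l < B" using assms by (auto simp: meets_def)
  then show ?thesis by (simp add: blocks_def)
next
  case False
  have "b \<noteq> 0" using assms False by (intro notI) (simp add: meets_def)
  then obtain b0 where b0: "b = Suc b0" by (cases b) auto
  have "i = B * b0 + (B + g - l)" "B + g - l < B"
    using assms False l_le_B by (auto simp: meets_def b0)
  then have "i div B = b0" by simp
  moreover have "cantor b0 = 0"
    using cantor_Suc[of b0] cantor_01[of b0] assms by (auto simp: meets_def b0)
  ultimately show ?thesis by (simp add: blocks_def b0 ones_Suc)
qed

text \<open>The blocks \<open>b - 1\<close>, \<open>b\<close>, \<open>b + 1\<close> look like the
  blocks 1, 2, 3: a copy of the first block between two zero blocks. The offset \<open>z\<close> is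
  measured from \<open>B\<close> letters before block \<open>b\<close>.\<close>

lemma cantor_around:
  assumes b: "cantor b = 1" and z: "z < 3 * B" "b = 0 \<longrightarrow> B \<le> z"
  shows "cantor (B * b + z - B) = cantor (B + z)"
proof -
  consider "z < B" | "B \<le> z" "z < 2 * B" | "2 * B \<le> z" by linarith
  then show ?thesis
  proof cases
    case 1
    then have "b \<noteq> 0" using z by auto
    then obtain b0 where b0: "b = Suc b0" by (cases b) auto
    have "cantor b0 = 0" using cantor_Suc[of b0] cantor_01[of b0] b by (auto simp: b0)
    then have "cantor (B * b + z - B) = 0" using cantor_B[OF 1, of b0] by (simp add: b0)
    moreover have "cantor (B + z) = 0" using cantor_B[OF 1, of 1] cantor_small by simp
    ultimately show ?thesis by simp
  next
    case 2
    then have eq: "B * b + z - B = B * b + (z - B)" "B + z = B * 2 + (z - B)" and "z - B < B" by auto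
    then show ?thesis unfolding eq using b cantor_B[of "z - B"] cantor_small by simp
  next
    case 3
    then have eq: "B * b + z - B = B * Suc b + (z - 2 * B)" "B + z = B * 3 + (z - 2 * B)"
      and lt: "z - 2 * B < B" using z by auto
    show ?thesis unfolding eq cantor_B[OF lt] using b cantor_Suc cantor_small by simp
  qed
qed

lemma win_near:
  assumes "cantor b = 1" "g < B + l" "i + l = B * b + g" "k \<le> Suc l"
  shows "win k i = win k (2 * B - l + g)"
  unfolding win_eq_iff
proof (intro allI impI)
  fix y assume y: "y < k"
  define z where "z = B + g - l + y"
  have "z < 3 * B" "b = 0 \<longrightarrow> B \<le> z" "B * b + z - B = i + y" "B + z = 2 * B - l + g + y"
    using y assms(2-4) l_le_B by (auto simp: z_def)
  then show "cantor (i + y) = cantor (2 * B - l + g + y)"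
    using cantor_around[OF assms(1), of z] by simp
qed

lemma st_zero_cantor:
  assumes "st i = 0" "y < l"
  shows "cantor (i + y) = 0"
proof (rule ccontr)
  assume "cantor (i + y) \<noteq> 0"
  then have one: "cantor (i + y) = 1" using cantor_01[of "i + y"] by simp
  define b where "b = (i + y) div B"
  have "cantor b = 1" using cantor_div_block[OF one, of m] by (simp add: b_def B_def)
  moreover have "B * b \<le> i + y" "i + y < B * b + B"
    using mult_div_mod_eq[of B "i + y"] mod_less_divisor[OF B_pos, of "i + y"]
    unfolding b_def by linarith+
  ultimately have "meets b (i + l - B * b) i" using assms(2) by (auto simp: meets_def)
  then show False using assms(1) st_zero_iff by blast
qed

lemma st_aligned:
  assumes "cantor q = 0"
  shows "st (B * q) = 0"
proof -
  have False if "meets b g (B * q)" for b g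
  proof -
    have *: "B * q + l = B * b + g" "g > 0" "g < B + l" "b \<noteq> q"
      using that assms by (auto simp: meets_def)
    consider "Suc b \<le> q" | "Suc q \<le> b" using *(4) by linarith
    then show False
      using mult_le_mono2[of "Suc b" q B] mult_le_mono2[of "Suc q" b B] * l_le_B
      by cases auto
  qed
  then show ?thesis using st_zero_iff by blast
qed

text \<open>The surroundings of all nonzero blocks look alike; the block with index \<open>2\<close> serves as
  the reference, since it is not at the start of the sequence.\<close>

definition ref_win :: "nat \<Rightarrow> nat list" where
  "ref_win g = win l (2 * B - l + g)"

lemma cantor_block1: "B \<le> y \<Longrightarrow> y < 2 * B \<Longrightarrow> cantor y = 0"
  using cantor_B[of "y - B" 1] cantor_small by simp

lemma ref_win_0: "ref_win 0 = replicate l 0"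
  unfolding ref_win_def win_eq_zero_iff using l_le_B by (auto intro!: cantor_block1)

lemma win_st: "win l i = ref_win (st i)"
proof (cases "st i = 0")
  case True
  then have "win l i = replicate l 0" using st_zero_cantor by (simp add: win_eq_zero_iff)
  then show ?thesis using True ref_win_0 by simp
next
  case False
  then obtain b where "meets b (st i) i" using st_pos by blast
  then show ?thesis unfolding ref_win_def by (intro win_near) (auto simp: meets_def)
qed

lemma cantor_block2: "r < B \<Longrightarrow> cantor (2 * B + r) = cantor r"
  using cantor_B[of r 2] cantor_small by (simp add: mult.commute)

text \<open>A block of length \<open>3 ^ m\<close> has the form \<open>V 0 V\<close>, where the three parts have length
  \<open>3 ^ (m - 1) < l\<close> and \<open>V\<close> starts and ends with a one.\<close>

lemma ref_win_has_one:
  assumes "0 < g" "g < B + l" "l > 0"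
  shows "\<exists>y<l. cantor (2 * B - l + g + y) = 1" (is ?thesis)
proof -
  have hit: ?thesis if "r < B" "cantor r = 1" "g \<le> r + l" "r < g" for r
    using that(1,2) cantor_block2[of r] that(3,4) l_le_B
    by (intro exI[of _ "r + l - g"]) auto
  show ?thesis
  proof (cases "g \<le> l")
    case True
    then show ?thesis using hit[of 0] assms cantor_small by simp
  next
    case gl: False
    show ?thesis
    proof (cases "g \<ge> B")
      case True
      have "B - 1 < g" using True B_pos by linarith
      then show ?thesis using hit[of "B - 1"] assms cantor_pow_minus_1[of m] by (auto simp: B_def)
    next
      case False
      define v :: nat where "v = 3 ^ (m - 1)"
      have "m = 0 \<longrightarrow> B = 1" unfolding B_def by simp
      then have "m \<noteq> 0" using gl False assms(3) by linarith
      then have v: "B = 3 * v" "v < l" "v > 0"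
        using l_gt power_Suc[of "3 :: nat" "m - 1"] by (simp_all add: B_def v_def)
      have c: "cantor (v - 1) = 1" "cantor (2 * v) = 1"
        using cantor_pow_minus_1[of "m - 1"] cantor_block[of 0 "m - 1" 2] cantor_small
        by (simp_all add: v_def mult.commute)
      show ?thesis
      proof (cases "g \<le> v - 1 + l")
        case True
        then show ?thesis using hit[of "v - 1"] c v gl by simp
      next
        case False
        then show ?thesis using hit[of "2 * v"] c v \<open>\<not> g \<ge> B\<close> by simp
      qed
    qed
  qed
qed

lemma one_in_blocks:
  assumes "cantor y = 1" "B \<le> y" "y < 4 * B"
  shows "2 * B \<le> y" "y < 3 * B"
proof -
  show "2 * B \<le> y" using assms cantor_block1[of y] by (intro leI notI) simp
  have "cantor y = 0" if "3 * B \<le> y"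
    using assms(3) that cantor_B[of "y - 3 * B" 3] cantor_small by (simp add: mult.commute)
  then show "y < 3 * B" using assms by (metis not_less zero_neq_one)
qed

lemma ref_win_eq_zero_iff:
  assumes "l > 0" "g < B + l"
  shows "ref_win g = ref_win 0 \<longleftrightarrow> g = 0"
proof
  assume "ref_win g = ref_win 0"
  then have "\<forall>y<l. cantor (2 * B - l + g + y) = 0"
    unfolding ref_win_0 unfolding ref_win_def win_eq_zero_iff .
  then show "g = 0" using ref_win_has_one[of g] assms by fastforce
qed simp

text \<open>Both windows show a one at the same offset, and both of these ones lie in
  \<open>[2 * B, 3 * B)\<close>.\<close>

lemma ref_win_near:
  assumes "l > 0" "0 < g" "g < B + l" "g' < B + l" "ref_win g = ref_win g'"
  shows "g' < g + B"
proof -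
  obtain y where y: "y < l" "cantor (2 * B - l + g + y) = 1"
    using ref_win_has_one assms by blast
  then have y': "cantor (2 * B - l + g' + y) = 1"
    using assms(5) by (simp add: ref_win_def win_eq_iff)
  show ?thesis
    using one_in_blocks[OF y(2)] one_in_blocks[OF y'] y(1) l_le_B assms by linarith
qed

text \<open>Equal numbers of ones before the two windows identify their ones at a common offset. So
  a window, together with the number of ones before it, determines the state.\<close>

lemma ref_win_inj:
  assumes "l > 0" "0 < g" "g < B + l" "ref_win g = ref_win g'"
    "ones (2 * B - l + g) = ones (2 * B - l + g')"
  shows "g = g'"
proof -
  obtain y where y: "y < l" "cantor (2 * B - l + g + y) = 1"
    using ref_win_has_one assms by blast
  have eq: "cantor (2 * B - l + g + y) = cantor (2 * B - l + g' + y)" if "y < l" for y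
    using assms(4) that by (simp add: ref_win_def win_eq_iff)
  have "ones (2 * B - l + g + y) = ones (2 * B - l + g' + y)"
    using eq y(1) assms(5) unfolding ones_add[of _ y] by (auto intro!: sum.cong)
  then show ?thesis using ones_inj[OF y(2)] eq[OF y(1)] y(2) by fastforce
qed

text \<open>A position runs through the states \<open>1, \<dots>, B + l - 1\<close> and then returns
  to 0; exactly at this return a nonzero block is completed.\<close>

lemma blocks_Suc:
  assumes "l > 0"
  shows "blocks (Suc i) = blocks i + of_bool (st i = B + l - 1)"
    and "st i = B + l - 1 \<Longrightarrow> st (Suc i) = 0"
    and "0 < st i \<Longrightarrow> st i < B + l - 1 \<Longrightarrow> st (Suc i) = Suc (st i)"
    and "st i = 0 \<Longrightarrow> st (Suc i) \<le> 1"
proof -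
  have last: "Suc i = B * Suc b" "cantor b = 1" if "meets b (B + l - 1) i" for b
    using that assms B_pos by (auto simp: meets_def)
  have meets_last: "\<exists>b. meets b (B + l - 1) i" if "st i = B + l - 1"
  proof -
    have "st i > 0" using that assms B_pos by linarith
    then show ?thesis using st_pos that by metis
  qed
  show "st i = B + l - 1 \<Longrightarrow> st (Suc i) = 0"
  proof -
    assume st: "st i = B + l - 1"
    then obtain b where "meets b (B + l - 1) i" using meets_last by blast
    then show "st (Suc i) = 0" using last[of b] cantor_Suc[of b] st_aligned[of "Suc b"] by simp
  qed
  show "st (Suc i) = Suc (st i)" if st: "0 < st i" "st i < B + l - 1"
  proof -
    obtain b where "meets b (st i) i" using st_pos[OF st(1)] by blast
    then show ?thesis using st by (intro st_eq[of b]) (auto simp: meets_def)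
  qed
  show "st (Suc i) \<le> 1" if "st i = 0"
  proof (rule ccontr)
    assume *: "\<not> st (Suc i) \<le> 1"
    then obtain b where "meets b (st (Suc i)) (Suc i)" using st_pos[of "Suc i"] by auto
    then have "meets b (st (Suc i) - 1) i" using * by (auto simp: meets_def)
    then show False using that st_zero_iff by blast
  qed
  show "blocks (Suc i) = blocks i + of_bool (st i = B + l - 1)"
  proof (cases "B dvd Suc i")
    case True
    then obtain q where "Suc i = B * q" by (auto elim: dvdE)
    then obtain b where b: "Suc i = B * Suc b" by (cases q) auto
    have ib: "i div B = b"
      using b B_pos mult_Suc_right[of B b] by (intro div_nat_eqI) linarith+
    have "cantor b = of_bool (st i = B + l - 1)"
    proof (cases "cantor b = 1")
      case True
      moreover have "0 < B + l - 1" "B + l - 1 < B + l" "i + l = B * b + (B + l - 1)"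
        using b assms B_pos mult_Suc_right[of B b] by linarith+
      ultimately have "meets b (B + l - 1) i" by (simp add: meets_def)
      then show ?thesis using st_eq True by simp
    next
      case False
      have "st i \<noteq> B + l - 1"
      proof
        assume st: "st i = B + l - 1"
        then obtain b' where "meets b' (B + l - 1) i" using meets_last by blast
        then show False using last[of b'] b False B_pos by simp
      qed
      then show ?thesis using False cantor_01[of b] by simp
    qed
    then show ?thesis using ib b by (simp add: blocks_def ones_Suc)
  next
    case False
    have "st i \<noteq> B + l - 1"
    proof
      assume st: "st i = B + l - 1"
      then obtain b where "meets b (B + l - 1) i" using meets_last by blast
      then show False using last[of b] False by simp
    qed
    moreover have "Suc i div B = i div B" using False by (simp add: div_Suc dvd_eq_mod_eq_0)
    ultimately show ?thesis by (simp add: blocks_def)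
  qed
qed

text \<open>The window of length \<open>l + 1\<close> at \<open>i\<close> is determined by the states of \<open>i\<close> and \<open>i + 1\<close>, and
  after each visit of the states \<open>1, \<dots>, B + l - 1\<close> the counts have grown by those of one
  full block.\<close>

lemma cnt_st:
  assumes l: "l > 0" and Q: "\<not> Q (replicate (Suc l) 0)"
  shows "cnt (Suc l) Q i + cnt (Suc l) Q (2 * B) =
    cnt (Suc l) Q (2 * B) * blocks i + cnt (Suc l) Q (2 * B - l + st i)"
proof (induction i)
  case 0
  \<comment> \<open>The first window starts with block 0, so the initial state is \<open>l\<close>,
    not 0.\<close>
  have "meets 0 l 0" using l B_pos cantor_small by (auto simp: meets_def)
  then show ?case using st_eq[of 0 l 0] l_le_B by (simp add: blocks_def)
next
  case (Suc i)
  let ?N = "cnt (Suc l) Q" and ?q = "\<lambda>y. of_bool (Q (win (Suc l) y)) :: nat"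
  have near: "win (Suc l) i = win (Suc l) (2 * B - l + st i)" if pos: "st i > 0"
  proof -
    obtain b where "meets b (st i) i" using st_pos pos by blast
    then show ?thesis by (intro win_near) (auto simp: meets_def)
  qed
  have zero: "win (Suc l) j = replicate (Suc l) 0" if "st j = 0" "st (Suc j) = 0" for j
    unfolding win_eq_zero_iff
  proof (intro allI impI)
    fix y assume "y < Suc l"
    then show "cantor (j + y) = 0"
      using st_zero_cantor[OF that(1), of y] st_zero_cantor[OF that(2), of "y - 1"] l
      by (cases "y < l") auto
  qed
  have gt: "B + l > 1" using l B_pos by linarith
  consider "st i = 0" "st (Suc i) = 0" | "st i = 0" "st (Suc i) = 1"
    | "st i > 0" "st i < B + l - 1" | "st i = B + l - 1" "st i > 0"
    using blocks_Suc(4)[OF l, of i] st_less[of i] l by linarith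
  then show ?case
  proof cases
    case 1
    then show ?thesis using Suc zero[of i] Q gt blocks_Suc(1)[OF l, of i] by (simp add: cnt_Suc)
  next
    case 2
    then obtain b where "meets b 1 (Suc i)" using st_pos[of "Suc i"] by auto
    then have "win (Suc l) i = win (Suc l) (2 * B - l + 0)"
      by (intro win_near) (auto simp: meets_def)
    then show ?thesis using Suc 2 gt blocks_Suc(1)[OF l, of i] by (simp add: cnt_Suc)
  next
    case 3
    then show ?thesis
      using Suc near l blocks_Suc(1,3)[OF l, of i] by (simp add: cnt_Suc)
  next
    case 4
    \<comment> \<open>Windows starting in block 2 count like those starting in block 0, and no
      window starting between \<open>B\<close> and \<open>2 * B - l\<close> contributes. So a full
      passage, from \<open>2 * B - l\<close> to \<open>3 * B\<close>, contributes
      \<open>?N (2 * B)\<close>.\<close>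
    have "?N (2 * B + B) = ?N (2 * B) + (\<Sum>j<B. ?q (2 * B + j))" by (rule cnt_add)
    also have "(\<Sum>j<B. ?q (2 * B + j)) = (\<Sum>j<B. ?q j)"
    proof (intro sum.cong refl)
      fix j assume "j \<in> {..<B}"
      then have "win (Suc l) j = win (Suc l) (2 * B - l + (j + l))"
        using cantor_small by (intro win_near[of 0]) auto
      then show "?q (2 * B + j) = ?q j" using l_le_B by simp
    qed
    also have "\<dots> = ?N B" by (simp add: cnt_def)
    also have "?N B = ?N (2 * B - l)"
    proof -
      have "(\<Sum>j<B - l. ?q (B + j)) = 0"
      proof (intro sum.neutral ballI)
        fix j assume "j \<in> {..<B - l}"
        then have "win (Suc l) (B + j) = replicate (Suc l) 0"
          unfolding win_eq_zero_iff by (auto intro!: cantor_block1)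
        then show "?q (B + j) = 0" using Q by simp
      qed
      then show ?thesis using cnt_add[of "Suc l" Q B "B - l"] l_le_B by (simp add: mult_2)
    qed
    finally have top: "?N (3 * B) = ?N (2 * B) + ?N (2 * B - l)" by (simp add: algebra_simps)
    have eq: "2 * B - l + st i = 3 * B - 1" and "Suc (3 * B - 1) = 3 * B"
      using l l_le_B 4(1) B_pos by linarith+
    then have "?N (2 * B - l + st i) + ?q i = ?N (3 * B)"
      using near[OF 4(2)] cnt_Suc[of "Suc l" Q "3 * B - 1"] unfolding eq by simp
    then show ?thesis
      using Suc top blocks_Suc(1,2)[OF l, of i] 4(1) by (simp add: cnt_Suc)
  qed
qed

lemma cnt_st_int:
  assumes l: "l > 0" and Q: "\<not> Q (replicate (Suc l) 0)"
  shows "int (cnt (Suc l) Q i) = int (cnt (Suc l) Q (2 * B)) * (int (blocks i) - 1)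
    + int (cnt (Suc l) Q (2 * B - l + st i))"
  using arg_cong[OF cnt_st[of Q i, OF assms], of int] by (simp add: algebra_simps)

text \<open>With \<open>ones (2 * B)\<close> ones per nonzero block, the part due to a cut block is
  a proper remainder modulo this number: the block ends with a one, which no state counts.\<close>

lemma ones_ref:
  assumes "g < B + l"
  shows "ones (2 * B) \<le> ones (2 * B - l + g)" "ones (2 * B - l + g) < 2 * ones (2 * B)"
    "ones (2 * B - l) = ones (2 * B)"
proof -
  have a: "ones (2 * B) = ones B" "ones (2 * B - l) = ones B"
    using l_le_B by (auto intro!: ones_const cantor_block1)
  have b: "ones (2 * B + B) = ones (2 * B) + ones B"
    using cantor_block2 unfolding ones_add[of _ B] by (simp add: ones_def)
  have "cantor (2 * B + (B - 1)) = 1"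
    using cantor_block2[of "B - 1"] cantor_pow_minus_1[of m] by (simp add: B_def)
  then have c: "ones (2 * B + (B - 1)) < ones (2 * B + B)" by (intro ones_less) auto
  have "ones (2 * B - l + g) \<le> ones (2 * B + (B - 1))"
    using assms l_le_B by (intro ones_mono) auto
  then show "ones (2 * B - l + g) < 2 * ones (2 * B)" using a b c by simp
  show "ones (2 * B - l) = ones (2 * B)" using a by simp
  show "ones (2 * B) \<le> ones (2 * B - l + g)" using a ones_mono[of "2 * B - l" "2 * B - l + g"] by simp
qed

text \<open>The number of zero windows is determined by the other numbers and the length of the factor,
  so it need not be compared.\<close>

definition same :: "nat \<Rightarrow> nat \<Rightarrow> nat \<Rightarrow> bool" where
  "same d i j \<longleftrightarrow> win l i = win l j \<and> win l (i + d) = win l (j + d) \<and>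
    (\<forall>Q. \<not> Q (replicate (Suc l) 0) \<longrightarrow>
      int (cnt (Suc l) Q (i + d)) - int (cnt (Suc l) Q i) =
      int (cnt (Suc l) Q (j + d)) - int (cnt (Suc l) Q j))"

text \<open>What a class retains of a pair of nonzero states. Distinct pairs can have the same
  shape, so shapes are counted rather than pairs.\<close>

definition shape :: "nat \<Rightarrow> nat \<Rightarrow> nat list \<times> nat list \<times> ((nat list \<Rightarrow> bool) \<Rightarrow> int)" where
  "shape g g' = (ref_win g, ref_win g', \<lambda>Q. if Q (replicate (Suc l) 0) then 0
    else int (cnt (Suc l) Q (2 * B - l + g')) - int (cnt (Suc l) Q (2 * B - l + g)))"

text \<open>A complete invariant of the class. The number of blocks is recorded only if an end is
  zero; between two nonzero ends it is already determined.\<close>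

definition key where
  "key d i = (if st i > 0 \<and> st (i + d) > 0 then Inr (shape (st i) (st (i + d)))
    else Inl (st i, st (i + d), blocks (i + d) - blocks i))"

section \<open>Completeness of the invariant\<close>

lemma blocks_mono: "i \<le> j \<Longrightarrow> blocks i \<le> blocks j"
  unfolding blocks_def by (intro ones_mono div_le_mono)

text \<open>The distances between the blocks met at both ends are even, and \<open>B\<close> times
  their difference is less than \<open>2 * B\<close> in absolute value by
  \<open>ref_win_near\<close>. So they agree, and \<open>ones_rigid\<close> applies.\<close>

lemma same_block_distance:
  assumes l: "l > 0" and
    pos: "st i > 0" "st (i + d) > 0" "st j > 0" "st (j + d) > 0" and
    eq: "ref_win (st i) = ref_win (st j)" "ref_win (st (i + d)) = ref_win (st (j + d))"
  shows "int (blocks (i + d)) - int (blocks i) = int (blocks (j + d)) - int (blocks j)"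
proof -
  obtain b b' c c' where m: "meets b (st i) i" "meets b' (st (i + d)) (i + d)"
    "meets c (st j) j" "meets c' (st (j + d)) (j + d)"
    using st_pos[OF pos(1)] st_pos[OF pos(2)] st_pos[OF pos(3)] st_pos[OF pos(4)] by metis
  have one: "cantor b = 1" "cantor b' = 1" "cantor c = 1" "cantor c' = 1"
    using m by (auto simp: meets_def)
  define x where "x = (int b' + int c) - (int b + int c')"
  have "even (b' + c)" "even (b + c')" using one[THEN cantor_even] by auto
  then have "even (int (b' + c) - int (b + c'))" by (simp only: even_diff even_add even_of_nat simp_thms)
  then have "even x" by (simp add: x_def)
  then obtain y where y: "x = 2 * y" by (auto elim: evenE)
  have "int B * x = int (st i) + int (st (j + d)) - int (st (i + d)) - int (st j)"
  proof -
    have "int i + int l = int B * int b + int (st i)" "int j + int l = int B * int c + int (st j)"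
      "int i + int d + int l = int B * int b' + int (st (i + d))"
      "int j + int d + int l = int B * int c' + int (st (j + d))"
      using m unfolding meets_def of_nat_mult[symmetric] of_nat_add[symmetric] by auto
    then show ?thesis unfolding x_def by (simp add: algebra_simps)
  qed
  moreover have "st i < st j + B" "st j < st i + B"
    "st (i + d) < st (j + d) + B" "st (j + d) < st (i + d) + B"
    using ref_win_near[OF l] pos st_less eq by metis+
  ultimately have "int B * x < int B * 2" "int B * (- 2) < int B * x" by auto
  then have "x < 2" "-2 < x" using B_pos by (simp_all only: mult_less_cancel_left_pos of_nat_0_less_iff)
  then have "x = 0" using y by simp
  then have "b' + c = c' + b" unfolding x_def by simp
  then have "ones b' + ones c = ones c' + ones b" by (intro ones_rigid one)
  then show ?thesis using m[THEN blocks_meets] by simp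
qed

lemma same_iff_key:
  assumes l: "l > 0"
  shows "same d i j \<longleftrightarrow> key d i = key d j"
proof -
  let ?K = "int (ones (2 * B))"
  let ?D = "\<lambda>i. int (blocks (i + d)) - int (blocks i)"
  let ?o = "\<lambda>g. int (ones (2 * B - l + g))"
  have cnt_diff: "int (cnt (Suc l) Q (i + d)) - int (cnt (Suc l) Q i) =
      int (cnt (Suc l) Q (2 * B)) * ?D i +
      (int (cnt (Suc l) Q (2 * B - l + st (i + d))) - int (cnt (Suc l) Q (2 * B - l + st i)))"
    if "\<not> Q (replicate (Suc l) 0)" for Q i
    using cnt_st_int[OF l, of Q i] cnt_st_int[OF l, of Q "i + d"] that by (simp add: algebra_simps)
  have D: "blocks (i + d) - blocks i = blocks (j + d) - blocks j \<longleftrightarrow> ?D i = ?D j"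
    using blocks_mono[of i "i + d"] blocks_mono[of j "j + d"] by auto
  have wins: "win l i = win l j \<and> win l (i + d) = win l (j + d) \<longleftrightarrow>
     ref_win (st i) = ref_win (st j) \<and> ref_win (st (i + d)) = ref_win (st (j + d))"
    unfolding win_st by simp
  have zero: "st x = 0 \<longleftrightarrow> st y = 0" if "ref_win (st x) = ref_win (st y)" for x y
    using that ref_win_eq_zero_iff[OF l] st_less by metis
  show ?thesis
  proof
    assume key: "key d i = key d j"
    show "same d i j"
    proof (cases "st i > 0 \<and> st (i + d) > 0")
      case True
      then have j: "st j > 0 \<and> st (j + d) > 0" using key by (auto simp: key_def split: if_splits)
      then have sh: "shape (st i) (st (i + d)) = shape (st j) (st (j + d))"
        using True key by (simp add: key_def)
      have eq: "ref_win (st i) = ref_win (st j)" "ref_win (st (i + d)) = ref_win (st (j + d))"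
        using sh by (auto simp: shape_def)
      have "?D i = ?D j" using same_block_distance[OF l _ _ _ _ eq] True j by simp
      then show ?thesis
        using eq wins sh unfolding same_def
        by (auto simp: cnt_diff shape_def fun_eq_iff split: if_splits)
    next
      case False
      then have "st i = st j" "st (i + d) = st (j + d)" "?D i = ?D j"
        using key D by (auto simp: key_def split: if_splits)
      then show ?thesis using wins unfolding same_def by (auto simp: cnt_diff)
    qed
  next
    assume same: "same d i j"
    then have eq: "ref_win (st i) = ref_win (st j)" "ref_win (st (i + d)) = ref_win (st (j + d))"
      using wins by (auto simp: same_def)
    show "key d i = key d j"
    proof (cases "st i > 0 \<and> st (i + d) > 0")
      case True
      then have j: "st j > 0 \<and> st (j + d) > 0" using zero[OF eq(1)] zero[OF eq(2)] by auto
      have "?D i = ?D j" using same_block_distance[OF l _ _ _ _ eq] True j by simp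
      then have "shape (st i) (st (i + d)) = shape (st j) (st (j + d))"
        using same eq unfolding same_def by (auto simp: cnt_diff shape_def fun_eq_iff)
      then show ?thesis using True j by (simp add: key_def)
    next
      case False
      then have j: "\<not> (st j > 0 \<and> st (j + d) > 0)" using zero[OF eq(1)] zero[OF eq(2)] by auto
      \<comment> \<open>Windows starting with a one count the ones among the first \<open>d\<close>
        letters of the factor: \<open>?K\<close> for each full block, plus the contribution of the
        cut blocks.\<close>
      have main: "?K * ?D i + (?o (st (i + d)) - ?o (st i)) = ?K * ?D j + (?o (st (j + d)) - ?o (st j))"
      proof -
        let ?Q = "\<lambda>w. hd w = (1 :: nat)"
        have Q: "\<not> ?Q (replicate (Suc l) 0)" by simp
        have "int (cnt (Suc l) ?Q (i + d)) - int (cnt (Suc l) ?Q i) =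
            int (cnt (Suc l) ?Q (j + d)) - int (cnt (Suc l) ?Q j)"
          using same Q unfolding same_def by (elim conjE allE[of _ ?Q]) simp
        then show ?thesis unfolding cnt_diff[of ?Q, OF Q] unfolding cnt_hd .
      qed
      have bounds: "?K \<le> ?o (st x)" "?o (st x) < 2 * ?K" for x
        using ones_ref(1,2)[OF st_less[of x]] by linarith+
      have o0: "?o 0 = ?K" using ones_ref(3)[of 0] B_pos by simp
      \<comment> \<open>Uniqueness of quotient and remainder separates the block count from the cut
        block.\<close>
      have split: "a = b \<and> r = s" if "?K * a + r = ?K * b + s" "0 \<le> r" "r < ?K" "0 \<le> s" "s < ?K"
        for a b r s :: int
      proof -
        have "(?K * a + r) div ?K = a" using that(2,3) by simp
        moreover have "(?K * b + s) div ?K = b" using that(4,5) by simp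
        ultimately have "a = b" using that(1) by simp
        then show ?thesis using that(1) by simp
      qed
      have "?D i = ?D j \<and> ?o (st i) = ?o (st j) \<and> ?o (st (i + d)) = ?o (st (j + d))"
      proof (cases "st i = 0")
        case True
        then have "st j = 0" using zero[OF eq(1)] by simp
        then show ?thesis
          using split[of "?D i" "?o (st (i + d)) - ?K" "?D j" "?o (st (j + d)) - ?K"]
            main True o0 bounds[of "i + d"] bounds[of "j + d"] by simp
      next
        case F: False
        then have *: "st (i + d) = 0" "st (j + d) = 0" using False j zero[OF eq(1)] zero[OF eq(2)] by auto
        \<comment> \<open>A nonzero prefix contributes with negative sign; exchanging the sides
          keeps the remainders nonnegative.\<close>
        then have "?K * ?D j + (?o (st i) - ?K) = ?K * ?D i + (?o (st j) - ?K)"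
          using main o0 by simp
        then show ?thesis
          using split[of "?D j" "?o (st i) - ?K" "?D i" "?o (st j) - ?K"]
            * bounds[of i] bounds[of j] by simp
      qed
      moreover have "st x = st y" if "ref_win (st x) = ref_win (st y)" "?o (st x) = ?o (st y)" for x y
        using ref_win_inj[OF l, of "st x" "st y"] that zero[OF that(1)] st_less[of x]
        by (cases "st x = 0") auto
      ultimately have "st i = st j" "st (i + d) = st (j + d)" "?D i = ?D j" using eq by auto
      then show ?thesis using False j D by (simp add: key_def)
    qed
  qed
qed

end

section \<open>Counting the equivalence classes\<close>

lemma card_quotient_image:
  assumes "\<And>i j. R (f i) (f j) \<longleftrightarrow> key i = key j"
  shows "card (range f // {(u, v). u \<in> range f \<and> v \<in> range f \<and> R u v}) = card (range key)"
proof -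
  define C where "C = (\<lambda>k. f ` {j. key j = k})"
  have cls: "{(u, v). u \<in> range f \<and> v \<in> range f \<and> R u v} `` {f i} = C (key i)" for i
    using assms by (auto simp: C_def)
  have "range f // {(u, v). u \<in> range f \<and> v \<in> range f \<and> R u v} =
    range (\<lambda>i. {(u, v). u \<in> range f \<and> v \<in> range f \<and> R u v} `` {f i})"
    unfolding quotient_def by blast
  also have "\<dots> = C ` range key" unfolding cls by (simp add: image_image)
  finally have "range f // {(u, v). u \<in> range f \<and> v \<in> range f \<and> R u v} = C ` range key" .
  moreover have "inj_on C (range key)"
  proof (rule inj_onI; safe)
    fix i i' assume "C (key i) = C (key i')"
    then have "f i \<in> C (key i')" unfolding C_def by blast
    then obtain j where "f i = f j" "key j = key i'" by (auto simp: C_def)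
    then show "key i = key i'" using assms by metis
  qed
  ultimately show ?thesis by (simp add: card_image)
qed

lemma factors_win: "factors cantor n = range (win n)"
  by (auto simp: factors_def win_def)

lemma pref_win: "k \<le> n \<Longrightarrow> pref k (win n i) = win k i"
  by (simp add: pref_def win_def take_map)

lemma suff_win: "k \<le> n \<Longrightarrow> suff k (win n i) = win k (i + n - k)"
  by (simp add: suff_def win_def drop_map)

lemma occ_win:
  assumes "length w = k" "k \<le> Suc n"
  shows "int (occ (win n i) w) = int (cnt k (\<lambda>u. u = w) (i + (Suc n - k))) - int (cnt k (\<lambda>u. u = w) i)"
proof -
  have "{y. y + length w \<le> length (win n i) \<and> take (length w) (drop y (win n i)) = w} =
    {y\<in>{..<Suc n - k}. win k (i + y) = w}"
    using assms by (auto simp: win_def take_map drop_map add.commute add.left_commute)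
  then have "occ (win n i) w = (\<Sum>y<Suc n - k. of_bool (win k (i + y) = w))"
    unfolding occ_def by (simp add: Collect_conj_eq Int_commute lessThan_def)
  then show ?thesis by (simp add: cnt_add)
qed

lemma cnt_sum_words:
  "cnt k Q i = (\<Sum>w\<in>{w. set w \<subseteq> {0, 1} \<and> length w = k \<and> Q w}. cnt k (\<lambda>u. u = w) i)"
proof -
  let ?W = "{w. set w \<subseteq> {0, 1} \<and> length w = k \<and> Q w}"
  have fin: "finite ?W"
    by (rule finite_subset[OF _ finite_lists_length_eq[of "{0, 1 :: nat}" k]]) auto
  have "(\<Sum>w\<in>?W. of_bool (win k y = w)) = (of_bool (Q (win k y)) :: nat)" for y
  proof -
    have "cantor x \<in> {0, 1}" for x using cantor_01[of x] by simp
    then have "set (win k y) \<subseteq> {0, 1}" unfolding win_def set_map by (rule image_subsetI)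
    then have "win k y \<in> ?W \<longleftrightarrow> Q (win k y)" by simp
    moreover have "(\<Sum>w\<in>?W. of_bool (win k y = w)) = (of_bool (win k y \<in> ?W) :: nat)"
      using fin by (simp add: of_bool_def)
    ultimately show ?thesis by simp
  qed
  then show ?thesis unfolding cnt_def by (subst sum.swap) simp
qed

lemma cnt_not: "cnt k (\<lambda>w. \<not> Q w) i + cnt k Q i = i"
  by (induction i) (auto simp: cnt_Suc)

context cantor_window
begin

text \<open>Counts for predicates are sums of counts for words. The restriction to predicates that
  fail on the zero word is harmless: a predicate and its complement together count all
  \<open>n - l\<close> windows of length \<open>l + 1\<close>.\<close>

lemma kab_equiv_iff_same:
  assumes n: "l \<le> n"
  shows "kab_equiv (Suc l) (win n i) (win n j) \<longleftrightarrow> same (n - l) i j"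
proof -
  let ?c = "\<lambda>Q i. int (cnt (Suc l) Q (i + (n - l))) - int (cnt (Suc l) Q i)"
  have occ: "int (occ (win n i) w) = ?c (\<lambda>u. u = w) i" if "length w = Suc l" for w i
    using occ_win[of w "Suc l" n i] that n by simp
  have ends: "pref (Suc l - 1) (win n i) = win l i" "suff (Suc l - 1) (win n i) = win l (i + (n - l))" for i
    using n by (simp_all add: pref_win suff_win)
  have all: "?c Q i = ?c Q j"
    if "\<And>w. length w = Suc l \<Longrightarrow> ?c (\<lambda>u. u = w) i = ?c (\<lambda>u. u = w) j" for Q
    unfolding cnt_sum_words[of _ Q] of_nat_sum sum_subtractf[symmetric]
    by (intro sum.cong that) auto
  have compl: "?c Q i = int (n - l) - ?c (\<lambda>w. \<not> Q w) i" for Q i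
    using cnt_not[of "Suc l" Q i] cnt_not[of "Suc l" Q "i + (n - l)"] by linarith
  have "(\<forall>w. length w = Suc l \<longrightarrow> occ (win n i) w = occ (win n j) w) \<longleftrightarrow>
    (\<forall>Q. \<not> Q (replicate (Suc l) 0) \<longrightarrow> ?c Q i = ?c Q j)"
  proof
    assume *: "\<forall>w. length w = Suc l \<longrightarrow> occ (win n i) w = occ (win n j) w"
    have eq: "?c (\<lambda>u. u = w) i = ?c (\<lambda>u. u = w) j" if w: "length w = Suc l" for w
      unfolding occ[OF w, symmetric] using * w by simp
    then show "\<forall>Q. \<not> Q (replicate (Suc l) 0) \<longrightarrow> ?c Q i = ?c Q j"
      using all[OF eq] by blast
  next
    assume *: "\<forall>Q. \<not> Q (replicate (Suc l) 0) \<longrightarrow> ?c Q i = ?c Q j"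
    have eq: "?c Q i = ?c Q j" for Q
    proof (cases "Q (replicate (Suc l) 0)")
      case True
      then show ?thesis
        using *[rule_format, of "\<lambda>w. \<not> Q w"] compl[of Q i] compl[of Q j] by simp
    next
      case False
      then show ?thesis by (rule *[rule_format])
    qed
    show "\<forall>w. length w = Suc l \<longrightarrow> occ (win n i) w = occ (win n j) w"
    proof (intro allI impI)
      fix w :: "nat list" assume w: "length w = Suc l"
      have "int (occ (win n i) w) = int (occ (win n j) w)" unfolding occ[OF w] by (rule eq)
      then show "occ (win n i) w = occ (win n j) w" by simp
    qed
  qed
  then show ?thesis unfolding kab_equiv_def ends same_def by blast
qed

section \<open>The block counts and pairs of states that occur\<close>

lemma ones_gap:
  assumes "st i = 0"
  obtains x where "i + l \<le> B * x" "blocks i = ones x"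
proof -
  \<comment> \<open>Round \<open>i + l\<close> up to a multiple of \<open>B\<close>. The blocks from
    \<open>i div B\<close> up to, but excluding, \<open>x\<close> would be met if they were
    nonzero.\<close>
  define x where "x = (i + l + (B - 1)) div B"
  have x: "i + l \<le> B * x" "B * x < i + l + B"
    using mult_div_mod_eq[of B "i + l + (B - 1)"] mod_less_divisor[OF B_pos, of "i + l + (B - 1)"] B_pos
    unfolding x_def by linarith+
  have "ones x = ones (i div B)"
  proof (rule ones_const)
    show "i div B \<le> x" unfolding x_def by (intro div_le_mono) simp
    fix q assume q: "i div B \<le> q" "q < x"
    have "B * Suc q \<le> B * x" using q by (intro mult_le_mono2) simp
    then have 1: "B * q < i + l" using x by simp
    have "i < B * Suc (i div B)" using dividend_less_times_div[OF B_pos] by simp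
    also have "\<dots> \<le> B * Suc q" using q by (intro mult_le_mono2) simp
    finally have 2: "i < B * q + B" by simp
    have "\<not> meets q (i + l - B * q) i" using assms st_zero_iff by blast
    then show "cantor q = 0" using 1 2 cantor_01[of q] by (auto simp: meets_def)
  qed
  then show thesis using that[of x] x by (simp add: blocks_def)
qed

lemma div_mult_add_le: "y \<le> B * x + z \<Longrightarrow> y div B \<le> x + z div B"
  using div_le_mono[of y "B * x + z" B] by simp

lemma st_zero_region:
  assumes "B * 3 ^ h \<le> i" "i + l \<le> B * (2 * 3 ^ h)"
  shows "st i = 0" "blocks i = ones (3 ^ h)"
proof -
  have False if m: "meets b g i" for b g
  proof -
    have *: "i + l = B * b + g" "0 < g" "g < B + l" "cantor b = 1" using m by (auto simp: meets_def)
    have "B * b < B * (2 * 3 ^ h)" "B * 3 ^ h < B * Suc b" using * assms unfolding mult_Suc_right by linarith+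
    then have "b < 2 * 3 ^ h" "3 ^ h \<le> b" unfolding mult_less_cancel1 less_Suc_eq_le by blast+
    then have "cantor b = 0" using cantor_block[of "b - 3 ^ h" h 1] cantor_small by simp
    then show False using * by simp
  qed
  then show "st i = 0" using st_zero_iff by blast
  have "3 ^ h \<le> i div B" using assms B_pos by (simp add: less_eq_div_iff_mult_less_eq mult.commute)
  moreover have "i div B \<le> 2 * 3 ^ h"
    using div_le_mono[of i "B * (2 * 3 ^ h)" B] assms B_pos by simp
  ultimately show "blocks i = ones (3 ^ h)" unfolding blocks_def by (rule ones_zero_block)
qed

text \<open>In the next three lemmas the upper bound is subadditivity of \<^const>\<open>ones\<close>.  It is attained,
  as are all smaller values, by a prefix of the sequence after a long gap, or by a suffix of a
  block of length \<open>3 ^ h\<close> before a long gap.\<close>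

lemma blocks_diff_zero_zero:
  assumes n: "2 * l \<le> n"
  shows "{blocks (i + (n - l)) - blocks i | i. st i = 0 \<and> st (i + (n - l)) = 0} =
    {..ones ((n - 2 * l) div B)}" (is "?A = ?B")
proof (intro equalityI subsetI)
  fix v assume "v \<in> ?A"
  then obtain i where i: "st i = 0" "v = blocks (i + (n - l)) - blocks i" by blast
  obtain x where x: "i + l \<le> B * x" "blocks i = ones x" using ones_gap[OF i(1)] by blast
  have "(i + (n - l)) div B \<le> x + (n - 2 * l) div B" using x n by (intro div_mult_add_le) auto
  then have "blocks (i + (n - l)) \<le> ones x + ones ((n - 2 * l) div B)"
    unfolding blocks_def using ones_mono ones_subadd le_trans by blast
  then show "v \<in> ?B" using i x by simp
next
  fix v assume v: "v \<in> ?B"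
  \<comment> \<open>The gap of \<open>3 ^ h\<close> zero blocks is longer than the factor.\<close>
  define h where "h = n + 1"
  have h: "n < 3 ^ h" using less_exp[of h] power_mono[of 2 "3 :: nat" h] by (simp add: h_def)
  then have Bh: "n < B * 3 ^ h" using B_pos by (metis less_le_trans mult.commute mult_le_mono2 mult.right_neutral Suc_leI One_nat_def)
  show "v \<in> ?A"
  proof (cases "v = 0")
    case True
    let ?i = "B * 3 ^ h"
    have "st ?i = 0" "st (?i + (n - l)) = 0" "blocks (?i + (n - l)) - blocks ?i = 0"
      using st_zero_region[of h ?i] st_zero_region[of h "?i + (n - l)"] n Bh by auto
    then show ?thesis using True by (intro CollectI exI[of _ ?i]) simp
  next
    case False
    obtain y where y: "y < (n - 2 * l) div B" "cantor y = 1" "ones (Suc y) = v"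
      using ones_reaches[of v "(n - 2 * l) div B"] v False by auto
    have By: "B * Suc y \<le> n - 2 * l"
      using y(1) B_pos by (metis Suc_leI div_times_less_eq_dividend le_trans mult.commute mult_le_mono2)
    have "B * 1 \<le> B * Suc y" by (intro mult_le_mono2) simp
    then have yh: "Suc y < 3 ^ h" using By h B_pos
      by (metis (no_types, opaque_lifting) diff_le_self le_less_trans le_trans mult_le_mono1 nat_mult_1 Suc_leI One_nat_def)
    \<comment> \<open>The suffix starts right after the \<open>v\<close>-th nonzero block behind the
      gap, and the prefix lies in the gap.\<close>
    define q where "q = 2 * 3 ^ h + Suc y"
    let ?i = "B * q - (n - l)"
    have "cantor q = 0" using cantor_block[OF yh, of 2] cantor_Suc[OF y(2)] by (simp add: q_def mult.commute)
    then have st': "st (B * q) = 0" by (rule st_aligned)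
    have Bq: "B * q = B * (2 * 3 ^ h) + B * Suc y" "B * (2 * 3 ^ h) = B * 3 ^ h + B * 3 ^ h"
      by (simp_all add: q_def algebra_simps)
    have i: "?i + (n - l) = B * q" "B * 3 ^ h \<le> ?i" "?i + l \<le> B * (2 * 3 ^ h)"
      using Bq Bh By n by linarith+
    have "blocks ?i = ones (2 * 3 ^ h)"
      using st_zero_region(2)[OF i(2,3)] ones_zero_block[of h "2 * 3 ^ h"] by simp
    moreover have "blocks (B * q) = ones (2 * 3 ^ h) + v"
      using ones_shift_pow[of "Suc y" h] yh y(3) B_pos by (simp add: blocks_def q_def)
    ultimately show ?thesis
      using st' i st_zero_region(1)[OF i(2,3)] by (intro CollectI exI[of _ ?i]) simp
  qed
qed

lemma blocks_diff_zero_pos: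
  assumes n: "2 * l + B \<le> n" and g: "0 < g" "g < B + l"
  shows "{blocks (i + (n - l)) - blocks i | i. st i = 0 \<and> st (i + (n - l)) = g} =
    {..<ones ((n + B - l - g) div B)}" (is "?A = ?B")
proof (intro equalityI subsetI)
  fix v assume "v \<in> ?A"
  then obtain i where i: "st i = 0" "st (i + (n - l)) = g" "v = blocks (i + (n - l)) - blocks i" by blast
  obtain b where b: "meets b g (i + (n - l))" using st_pos[of "i + (n - l)"] i g by metis
  obtain x where x: "i + l \<le> B * x" "blocks i = ones x" using ones_gap[OF i(1)] by blast
  \<comment> \<open>Block \<open>b\<close>, met by the suffix, is not counted by
    \<open>blocks\<close>. Including it here makes the final inequality strict.\<close>
  have "B * Suc b \<le> B * x + (n + B - l - g)" using b x n g by (auto simp: meets_def)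
  then have "Suc b \<le> x + (n + B - l - g) div B" using div_mult_add_le[of "B * Suc b"] by simp
  then have "ones (Suc b) \<le> ones x + ones ((n + B - l - g) div B)"
    using ones_mono ones_subadd le_trans by blast
  moreover have "cantor b = 1" using b by (simp add: meets_def)
  ultimately have "ones b < ones x + ones ((n + B - l - g) div B)" by (simp add: ones_Suc)
  then show "v \<in> ?B" using i x blocks_meets[OF b] blocks_mono[of i "i + (n - l)"] by simp
next
  fix v assume v: "v \<in> ?B"
  define h where "h = n + 1"
  have h: "n < 3 ^ h" using less_exp[of h] power_mono[of 2 "3 :: nat" h] by (simp add: h_def)
  then have Bh: "n < B * 3 ^ h" using B_pos by (metis less_le_trans mult.commute mult_le_mono2 mult.right_neutral Suc_leI One_nat_def)
  obtain y where y: "y < (n + B - l - g) div B" "cantor y = 1" "ones (Suc y) = Suc v"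
    using ones_reaches[of "Suc v" "(n + B - l - g) div B"] v by auto
  have "B * Suc y \<le> n + B - l - g"
    using y(1) B_pos by (metis Suc_leI div_times_less_eq_dividend le_trans mult.commute mult_le_mono2)
  then have By: "B * y + g \<le> n - l" using n g by simp
  have yh: "y < 3 ^ h" using By h B_pos
    by (metis (no_types, opaque_lifting) add_leD1 diff_le_self le_less_trans le_trans mult_le_mono1 nat_mult_1 Suc_leI One_nat_def)
  define q where "q = 2 * 3 ^ h + y"
  let ?i = "B * q + g - n"
  have q: "cantor q = 1" using cantor_block[OF yh, of 2] cantor_small y(2) by (simp add: q_def mult.commute)
  have Bq: "B * q = B * (2 * 3 ^ h) + B * y" "B * (2 * 3 ^ h) = B * 3 ^ h + B * 3 ^ h"
    by (simp_all add: q_def algebra_simps)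
  have i: "?i + (n - l) + l = B * q + g" "B * 3 ^ h \<le> ?i" "?i + l \<le> B * (2 * 3 ^ h)"
    using Bq Bh By n by linarith+
  have m: "meets q g (?i + (n - l))" using i q g by (simp add: meets_def)
  have "blocks ?i = ones (2 * 3 ^ h)"
    using st_zero_region(2)[OF i(2,3)] ones_zero_block[of h "2 * 3 ^ h"] by simp
  moreover have "ones q = ones (2 * 3 ^ h) + v"
    using ones_shift_pow[of y h] yh y(2,3) by (simp add: q_def ones_Suc)
  ultimately show "v \<in> ?A"
    using st_eq[OF m] blocks_meets[OF m] st_zero_region(1)[OF i(2,3)]
    by (intro CollectI exI[of _ ?i]) simp
qed

lemma blocks_diff_pos_zero:
  assumes n: "2 * l + B \<le> n" and g: "0 < g" "g < B + l"
  shows "{blocks (i + (n - l)) - blocks i | i. st i = g \<and> st (i + (n - l)) = 0} =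
    {1..ones ((n + g - 2 * l) div B)}" (is "?A = ?B")
proof (intro equalityI subsetI)
  let ?N = "(n + g - 2 * l) div B"
  fix v assume "v \<in> ?A"
  then obtain i where i: "st i = g" "v = blocks (i + (n - l)) - blocks i" by blast
  obtain b where b: "meets b g i" using st_pos[of i] i g by metis
  have "i + (n - l) = B * b + (n + g - 2 * l)" using b n by (auto simp: meets_def)
  then have eq: "blocks (i + (n - l)) = ones (b + ?N)" by (simp add: blocks_def)
  \<comment> \<open>The block met by the prefix is itself counted, which excludes the value
    0.\<close>
  have "?N \<ge> 1" using n B_pos by (simp add: less_eq_div_iff_mult_less_eq)
  then have "ones b < ones (b + ?N)" using b by (intro ones_less) (auto simp: meets_def)
  then show "v \<in> ?B"
    using ones_subadd[of b ?N] i eq blocks_meets[OF b] unfolding atLeastAtMost_iff by linarith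
next
  fix v assume v: "v \<in> ?B"
  define h where "h = n + B + 1"
  have h: "n + B < 3 ^ h" using less_exp[of h] power_mono[of 2 "3 :: nat" h] by (simp add: h_def)
  then have Bh: "n + B < B * 3 ^ h" using B_pos by (metis less_le_trans mult.commute mult_le_mono2 mult.right_neutral Suc_leI One_nat_def)
  obtain y where y: "y < (n + g - 2 * l) div B" "cantor y = 1" "ones (Suc y) = v"
    using ones_reaches[of v "(n + g - 2 * l) div B"] v by auto
  have By: "B * Suc y \<le> n + g - 2 * l"
    using y(1) B_pos by (metis Suc_leI div_times_less_eq_dividend le_trans mult.commute mult_le_mono2)
  have "Suc y \<le> n + g - 2 * l" by (rule le_trans[OF _ By]) (use mult_le_mono1[OF Suc_leI[OF B_pos], of "Suc y"] in simp)
  then have yh: "Suc y < 3 ^ h" using h g n by linarith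
  \<comment> \<open>By mirror symmetry the last \<open>v\<close> nonzero blocks before the gap start
    with block \<open>q\<close>; the suffix lies in the gap.\<close>
  define q where "q = 3 ^ h - Suc y"
  let ?i = "B * q + g - l"
  have q: "cantor q = 1" using cantor_mirror[of y h] yh y(2) by (simp add: q_def)
  have "B * 1 \<le> B * q" using yh by (intro mult_le_mono2) (simp add: q_def)
  moreover have "B * q + B * Suc y = B * 3 ^ h" using yh unfolding distrib_left[symmetric] q_def by simp
  ultimately have i: "?i + l = B * q + g" "B * 3 ^ h \<le> ?i + (n - l)"
    "?i + (n - l) + l \<le> B * (2 * 3 ^ h)"
    using Bh By n g l_le_B by auto
  have m: "meets q g ?i" using i q g by (simp add: meets_def)
  have "ones (3 ^ h) = ones q + v" using ones_mirror[of "Suc y" h] yh y(3) by (simp add: q_def)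
  then show "v \<in> ?A"
    using st_eq[OF m] blocks_meets[OF m] st_zero_region[OF i(2,3)]
    by (intro CollectI exI[of _ ?i]) simp
qed

text \<open>The blocks met at the two ends are \<open>(n - l + g - g') / B\<close> blocks apart; the
  divisibility makes this an even integer.\<close>

definition feasible :: "nat \<Rightarrow> (nat \<times> nat) set" where
  "feasible n = {(g, g'). 0 < g \<and> g < B + l \<and> 0 < g' \<and> g' < B + l \<and>
    int (2 * B) dvd int n - int l + int g - int g'}"

lemma states_pos_pos:
  assumes n: "2 * l + B \<le> n"
  shows "{(st i, st (i + (n - l))) | i. st i > 0 \<and> st (i + (n - l)) > 0} = feasible n" (is "?A = _")
proof (intro equalityI subsetI)
  fix p assume "p \<in> ?A"
  then obtain i where i: "p = (st i, st (i + (n - l)))" "st i > 0" "st (i + (n - l)) > 0" by blast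
  obtain b where b: "meets b (st i) i" using st_pos[OF i(2)] by blast
  obtain b' where b': "meets b' (st (i + (n - l))) (i + (n - l))" using st_pos[OF i(3)] by blast
  have even: "even (int b' - int b)"
    using b b' cantor_even[of b] cantor_even[of b'] by (simp add: meets_def)
  obtain y where y: "int b' - int b = 2 * y" by (rule evenE[OF even])
  have "int i + int l = int B * int b + int (st i)"
    "int i + int (n - l) + int l = int B * int b' + int (st (i + (n - l)))"
    using b b' unfolding meets_def of_nat_mult[symmetric] of_nat_add[symmetric] by auto
  then have "int n - int l + int (st i) - int (st (i + (n - l))) = int B * (int b' - int b)"
    using n by (simp add: algebra_simps)
  also have "\<dots> = int (2 * B) * y" using y by simp
  finally have "int (2 * B) dvd int n - int l + int (st i) - int (st (i + (n - l)))" by simp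
  then show "p \<in> feasible n" using i st_less by (simp add: feasible_def)
next
  fix p assume "p \<in> feasible n"
  then obtain g g' where p: "p = (g, g')" "0 < g" "g < B + l" "0 < g'" "g' < B + l"
    "int (2 * B) dvd int n - int l + int g - int g'" by (auto simp: feasible_def)
  then obtain y where y: "int n - int l + int g - int g' = int (2 * B) * y" by (auto elim: dvdE)
  have "0 \<le> int (2 * B) * y" using y n p by linarith
  then have "y \<ge> 0" using B_pos by (simp add: zero_le_mult_iff)
  then obtain K where K: "y = int K" by (metis nonneg_int_cases)
  obtain b where b: "b \<ge> 1" "cantor b = 1" "cantor (b + 2 * K) = 1" using cantor_distances by blast
  let ?i = "B * b + g - l"
  have "B * 1 \<le> B * b" using b by (intro mult_le_mono2)
  then have i: "?i + l = B * b + g" using l_le_B by linarith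
  have "int (n + g) = int (l + g' + 2 * B * K)" using y K by simp
  then have "n + g = l + g' + 2 * B * K" by (simp only: of_nat_eq_iff)
  then have i': "?i + (n - l) + l = B * (b + 2 * K) + g'" using i n by (simp add: algebra_simps)
  have "meets b g ?i" "meets (b + 2 * K) g' (?i + (n - l))" using i i' p b by (auto simp: meets_def)
  then have "st ?i = g" "st (?i + (n - l)) = g'" by (auto dest: st_eq)
  then show "p \<in> ?A" using p by (intro CollectI exI[of _ ?i]) simp
qed

lemma feasible_periodic: "feasible (n + 2 * B) = feasible n"
proof -
  have "int (2 * B) dvd int (n + 2 * B) - int l + int g - int g' \<longleftrightarrow>
    int (2 * B) dvd int n - int l + int g - int g'" for g g'
  proof -
    have "int (n + 2 * B) - int l + int g - int g' = (int n - int l + int g - int g') + int (2 * B)" by simp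
    then show ?thesis by (simp only: dvd_add_left_iff dvd_refl)
  qed
  then show ?thesis by (simp add: feasible_def)
qed

text \<open>Keys are of four disjoint kinds, according to which ends are zero. The
  \<open>Suc\<close> stems from the block count 0 between two zero ends.\<close>

lemma kab_complexity_formula:
  assumes l: "l > 0" and n: "2 * l + B \<le> n"
  shows "kab_complexity (Suc l) cantor n =
    Suc (ones ((n - 2 * l) div B)) + (\<Sum>g\<in>{0<..<B + l}. ones ((n + B - l - g) div B)) +
    (\<Sum>g\<in>{0<..<B + l}. ones ((n + g - 2 * l) div B)) +
    card ((\<lambda>(g, g'). shape g g') ` feasible n)"
proof -
  let ?S = "{0<..<B + l}"
  let ?d = "n - l"
  define Z where "Z = (\<lambda>v. (0 :: nat, 0 :: nat, v)) ` {..ones ((n - 2 * l) div B)}"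
  define R where "R = (\<lambda>(g, v). (0 :: nat, g, v)) ` (SIGMA g:?S. {..<ones ((n + B - l - g) div B)})"
  define L where "L = (\<lambda>(g, v). (g, 0 :: nat, v)) ` (SIGMA g:?S. {1..ones ((n + g - 2 * l) div B)})"
  define P where "P = (\<lambda>(g, g'). shape g g') ` feasible n"
  have 00: "{blocks (i + ?d) - blocks i | i. st i = 0 \<and> st (i + ?d) = 0} = {..ones ((n - 2 * l) div B)}"
    using n by (intro blocks_diff_zero_zero) simp
  note 01 = blocks_diff_zero_pos[OF n] and 10 = blocks_diff_pos_zero[OF n] and 11 = states_pos_pos[OF n]
  have "range (key ?d) = Inl ` (Z \<union> R \<union> L) \<union> Inr ` P"
  proof (intro equalityI subsetI)
    fix x assume "x \<in> range (key ?d)"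
    then obtain i where x: "x = key ?d i" by blast
    let ?g = "st i" and ?g' = "st (i + ?d)" and ?v = "blocks (i + ?d) - blocks i"
    consider "?g = 0" "?g' = 0" | "?g = 0" "?g' > 0" | "?g > 0" "?g' = 0" | "?g > 0" "?g' > 0" by blast
    then show "x \<in> Inl ` (Z \<union> R \<union> L) \<union> Inr ` P"
    proof cases
      case 1
      then have "?v \<in> {..ones ((n - 2 * l) div B)}" unfolding 00[symmetric] by blast
      then show ?thesis using 1 unfolding x key_def Z_def by auto
    next
      case 2
      then have "?v \<in> {..<ones ((n + B - l - ?g') div B)}"
        using 01[of ?g'] st_less[of "i + ?d"] by blast
      then show ?thesis using 2 st_less[of "i + ?d"] unfolding x key_def R_def by force
    next
      case 3
      then have "?v \<in> {1..ones ((n + ?g - 2 * l) div B)}"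
        using 10[of ?g] st_less[of i] by blast
      then show ?thesis using 3 st_less[of i] unfolding x key_def L_def by force
    next
      case 4
      then have "(?g, ?g') \<in> feasible n" unfolding 11[symmetric] by blast
      then show ?thesis using 4 unfolding x key_def P_def by force
    qed
  next
    fix x assume "x \<in> Inl ` (Z \<union> R \<union> L) \<union> Inr ` P"
    then consider v where "x = Inl (0, 0, v)" "v \<in> {..ones ((n - 2 * l) div B)}"
      | g v where "x = Inl (0, g, v)" "0 < g" "g < B + l" "v \<in> {..<ones ((n + B - l - g) div B)}"
      | g v where "x = Inl (g, 0, v)" "0 < g" "g < B + l" "v \<in> {1..ones ((n + g - 2 * l) div B)}"
      | g g' where "x = Inr (shape g g')" "(g, g') \<in> feasible n"
      unfolding Z_def R_def L_def P_def by fastforce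
    then show "x \<in> range (key ?d)"
    proof cases
      case 1
      then obtain i where "v = blocks (i + ?d) - blocks i" "st i = 0" "st (i + ?d) = 0"
        unfolding 00[symmetric] by blast
      then show ?thesis using 1 by (intro image_eqI[of _ _ i]) (simp_all add: key_def)
    next
      case 2
      then obtain i where "v = blocks (i + ?d) - blocks i" "st i = 0" "st (i + ?d) = g"
        using 01[of g] by blast
      then show ?thesis using 2 by (intro image_eqI[of _ _ i]) (simp_all add: key_def)
    next
      case 3
      then obtain i where "v = blocks (i + ?d) - blocks i" "st i = g" "st (i + ?d) = 0"
        using 10[of g] by blast
      then show ?thesis using 3 by (intro image_eqI[of _ _ i]) (simp_all add: key_def)
    next
      case 4
      then obtain i where "st i = g" "st (i + ?d) = g'" "st i > 0" "st (i + ?d) > 0"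
        unfolding 11[symmetric] by blast
      then show ?thesis using 4 by (intro image_eqI[of _ _ i]) (simp_all add: key_def)
    qed
  qed
  moreover have "finite (feasible n)"
    by (rule finite_subset[of _ "{..<B + l} \<times> {..<B + l}"]) (auto simp: feasible_def)
  then have "finite P" by (simp add: P_def)
  moreover have fin: "finite Z" "finite R" "finite L"
    unfolding Z_def R_def L_def by (auto intro!: finite_imageI finite_SigmaI)
  moreover have "card (Z \<union> R \<union> L) = card Z + card R + card L"
  proof -
    have "Z \<inter> R = {}" "(Z \<union> R) \<inter> L = {}" unfolding Z_def R_def L_def by auto
    then show ?thesis using fin by (simp add: card_Un_disjoint)
  qed
  moreover have "card Z = Suc (ones ((n - 2 * l) div B))"
    unfolding Z_def by (subst card_image) (auto simp: inj_on_def)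
  moreover have "card R = (\<Sum>g\<in>?S. ones ((n + B - l - g) div B))"
    unfolding R_def by (subst card_image) (auto simp: inj_on_def)
  moreover have "card L = (\<Sum>g\<in>?S. ones ((n + g - 2 * l) div B))"
    unfolding L_def by (subst card_image) (auto simp: inj_on_def)
  ultimately have "card (range (key ?d)) = Suc (ones ((n - 2 * l) div B)) +
    (\<Sum>g\<in>?S. ones ((n + B - l - g) div B)) + (\<Sum>g\<in>?S. ones ((n + g - 2 * l) div B)) + card P"
    by (subst \<open>range (key ?d) = _\<close>, subst card_Un_disjoint) (auto simp: card_image)
  moreover have "kab_complexity (Suc l) cantor n = card (range (key ?d))"
    unfolding kab_complexity_def factors_win
    using n by (intro card_quotient_image) (simp add: kab_equiv_iff_same same_iff_key[OF l])
  ultimately show ?thesis by (simp add: P_def)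
qed

end

section \<open>The case \<open>k = 1\<close> and the regularity of the complexity\<close>

lemma kab_complexity_one: "kab_complexity 1 cantor n = Suc (ones n)"
proof -
  \<comment> \<open>Blocks of length 1 and empty windows: every state is 0, and only the number of
    ones matters.\<close>
  interpret cantor_window 0 0 by unfold_locales auto
  have B: "B = 1" by (simp add: B_def)
  have st: "st i = 0" for i using st_less[of i] B by simp
  have blocks: "blocks i = ones i" for i by (simp add: blocks_def B)
  have same: "same n i j \<longleftrightarrow> ones (i + n) - ones i = ones (j + n) - ones j" for i j
  proof -
    have cnt: "cnt (Suc 0) Q i = of_bool (Q [1]) * ones i" if "\<not> Q [0]" for Q i
    proof -
      have "of_bool (Q (win (Suc 0) y)) = of_bool (Q [1]) * cantor y" for y
        using that cantor_01[of y] by (auto simp: win_def)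
      then show ?thesis by (simp add: cnt_def ones_def sum_distrib_left)
    qed
    have "same n i j \<longleftrightarrow> (\<forall>Q. \<not> Q [0 :: nat] \<longrightarrow>
      int (cnt (Suc 0) Q (i + n)) - int (cnt (Suc 0) Q i) =
      int (cnt (Suc 0) Q (j + n)) - int (cnt (Suc 0) Q j))"
      by (simp add: same_def win_def)
    also have "\<dots> \<longleftrightarrow> int (ones (i + n)) - int (ones i) = int (ones (j + n)) - int (ones j)"
      by (auto simp: cnt dest: spec[of _ "\<lambda>w. w = [1]"])
    also have "\<dots> \<longleftrightarrow> ones (i + n) - ones i = ones (j + n) - ones j"
      using ones_mono[of i "i + n"] ones_mono[of j "j + n"] by auto
    finally show ?thesis .
  qed
  have "kab_complexity 1 cantor n = card (range (\<lambda>i. ones (i + n) - ones i))"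
    unfolding kab_complexity_def factors_win One_nat_def
    using kab_equiv_iff_same[of n] same by (intro card_quotient_image) simp
  also have "range (\<lambda>i. ones (i + n) - ones i) = {..ones n}"
    using blocks_diff_zero_zero[of n] by (simp add: st blocks B full_SetCompr_eq)
  finally show ?thesis by simp
qed

lemma nat_shift_div:
  fixes c :: int
  assumes "int a = int n + c"
  shows "a div b = nat ((int n + c) div int b)"
  unfolding assms[symmetric] zdiv_int[symmetric] by simp

theorem theorem1p3:
  fixes k :: nat
  assumes "k \<ge> 1"
  shows "regular_seq 3 (\<lambda>n. int (kab_complexity k cantor n))"
proof (rule representable_regular)
  show "representable 3 (\<lambda>n. int (kab_complexity k cantor n))"
  proof (cases "k = 1")
    case True
    have "representable 3 (\<lambda>n. 1 + int (ones n))"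
      using representable_add[OF representable_eventually_periodic[of 0 "\<lambda>_. 1" 1 3] representable_ones[of 0 0]]
      by simp
    then show ?thesis using True kab_complexity_one by simp
  next
    case False
    define l where "l = k - 1"
    have l: "l > 0" "k = Suc l" using assms False by (auto simp: l_def)
    define m where "m = (LEAST m. l \<le> 3 ^ m)"
    have "l \<le> 3 ^ l" using less_exp[of l] power_mono[of 2 "3 :: nat" l] by simp
    then have m: "l \<le> 3 ^ m" unfolding m_def by (rule LeastI)
    have "m = 0 \<or> 3 ^ (m - 1) < l"
      using not_less_Least[of "m - 1" "\<lambda>m. l \<le> 3 ^ m"] unfolding m_def[symmetric] by linarith
    then interpret cantor_window l m using m by unfold_locales
    let ?S = "{0<..<B + l}"
    define F where "F c = (\<lambda>n. int (ones (nat ((int n + c) div 3 ^ m))))" for c :: int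
    \<comment> \<open>From \<open>2 * l + B\<close> on, \<open>E\<close> is 1 plus the number of
      shapes, which depends only on \<open>feasible n\<close> and has period \<open>2 * B\<close>.
      As an integer difference, \<open>E\<close> makes the decomposition valid for small
      \<open>n\<close> too.\<close>
    define E where "E = (\<lambda>n. int (kab_complexity k cantor n) -
      (F (- 2 * int l) n + (\<Sum>g\<in>?S. F (int B - int l - int g) n) + (\<Sum>g\<in>?S. F (int g - 2 * int l) n)))"
    have F: "int (ones (a div B)) = F c n" if "int a = int n + c" for a c n
      using nat_shift_div[OF that, of B] by (simp add: F_def B_def)
    have E: "E n = 1 + int (card ((\<lambda>(g, g'). shape g g') ` feasible n))" if n: "2 * l + B \<le> n" for n
    proof -
      have "int (ones ((n - 2 * l) div B)) = F (- 2 * int l) n" using n by (intro F) simp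
      moreover have "int (ones ((n + B - l - g) div B)) = F (int B - int l - int g) n" if "g \<in> ?S" for g
        using n that by (intro F) simp
      moreover have "int (ones ((n + g - 2 * l) div B)) = F (int g - 2 * int l) n" if "g \<in> ?S" for g
        using n that by (intro F) simp
      ultimately show ?thesis unfolding E_def l(2) kab_complexity_formula[OF l(1) n] by simp
    qed
    have "representable 3 E"
      using B_pos by (intro representable_eventually_periodic[of "2 * l + B" E "2 * B"])
        (auto simp: E feasible_periodic)
    moreover have "representable 3 (F c)" for c unfolding F_def by (rule representable_ones)
    ultimately have "representable 3 (\<lambda>n. E n + (F (- 2 * int l) n +
      (\<Sum>g\<in>?S. F (int B - int l - int g) n) + (\<Sum>g\<in>?S. F (int g - 2 * int l) n)))"
      by (intro representable_add representable_sum) auto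
    then show ?thesis by (simp add: E_def)
  qed
qed simp

end
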